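(* Let $k$ be an algebraically closed field of characteristic $0$, regarded in the language $\mathcal{F}$, and let $\mathcal{A}$ be a finite-dimensional $k$-algebra. Assume $G<\mathrm{Aut}(\mathcal{A})_{\mathcal{F}}$ is a finite linear algebraic group (a finite subgroup of $\mathrm{GL}(\mathcal{A})$ consisting of algebra automorphisms). For each $m\in\mathbb{N}$ let $S_m$ be a minimal generating set of the invariant algebra $k[\mathcal{A}^m]^G$. Let $(\mathcal{F},E)$ be a language extension, interpreted in $\mathcal{A}$, such that (a) each symbol $e\in E$ of arity $r$ is interpreted as a map $\mathcal{A}^r\to\mathcal{A}$ of the form $\underline{a}\mapsto\iota(p(\underline{a}))$ for some $p\in k[\mathcal{A}^r]^G$, and (b) for every $m$ and every $s\in S_m$, the map $\underline{a}\mapsto\iota(s(\underline{a}))$ on $\mathcal{A}^m$ is the evaluation of some $(\mathcal{F},E)$-term. Then the $(\mathcal{F},E)$-structure $\mathcal{A}$ admits quantifier elimination.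
   Context: $\mathcal{F}=(+,-,\times,0,1)$ is the ring language; a (unital, not necessarily associative) $k$-algebra $\mathcal{A}$ is an $\mathcal{F}$-structure via its operations and $0_\mathcal{A},1_\mathcal{A}$. $\mathrm{Aut}(\mathcal{A})_{\mathcal{F}}$ is the group of bijections preserving these. $\iota:k\to k1_\mathcal{A}$, $c\mapsto c1_\mathcal{A}$. $k[\mathcal{A}^m]$ is the ring of polynomial functions on the $k$-vector space $\mathcal{A}^m$; $G$ acts diagonally on $\mathcal{A}^m$ and on $k[\mathcal{A}^m]$ by $(g\cdot f)(v)=f(g^{-1}v)$; $k[\mathcal{A}^m]^G$ is the subalgebra of $G$-invariant functions. Quantifier elimination means every first-order definable subset of $\mathcal{A}^m$ is definable by a quantifier-free formula. *)

theory Defs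
  imports "HOL-Algebra.Group" "HOL-Computational_Algebra.Polynomial" "HOL-Library.FuncSet"
begin

section \<open>First-order logic over a functional signature\<close>

text \<open>
  A signature is a set \<open>L\<close> of function symbols with an arity function \<open>ar\<close>; constants are symbols
  of arity 0, and equality is the only relation. Variables are de Bruijn indices into a list of
  elements: a quantifier pushes its witness onto the front of the list, so the formulas that are
  well-formed for \<open>n\<close> have their free variables among \<open>0, \<dots>, n - 1\<close>.
\<close>

datatype 'f trm = Var nat | Fn 'f "'f trm list"

datatype 'f fm = Eql "'f trm" "'f trm" | Neg "'f fm" | Conj "'f fm" "'f fm" | Exi "'f fm"

fun wf_trm :: "'f set \<Rightarrow> ('f \<Rightarrow> nat) \<Rightarrow> nat \<Rightarrow> 'f trm \<Rightarrow> bool" where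
  "wf_trm L ar n (Var i) \<longleftrightarrow> i < n"
| "wf_trm L ar n (Fn f ts) \<longleftrightarrow>
     f \<in> L \<and> length ts = ar f \<and> (\<forall>t \<in> set ts. wf_trm L ar n t)"

primrec wf_fm :: "'f set \<Rightarrow> ('f \<Rightarrow> nat) \<Rightarrow> nat \<Rightarrow> 'f fm \<Rightarrow> bool" where
  "wf_fm L ar n (Eql s t) \<longleftrightarrow> wf_trm L ar n s \<and> wf_trm L ar n t"
| "wf_fm L ar n (Neg \<phi>) \<longleftrightarrow> wf_fm L ar n \<phi>"
| "wf_fm L ar n (Conj \<phi> \<psi>) \<longleftrightarrow> wf_fm L ar n \<phi> \<and> wf_fm L ar n \<psi>"
| "wf_fm L ar n (Exi \<phi>) \<longleftrightarrow> wf_fm L ar (Suc n) \<phi>"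

primrec qfree :: "'f fm \<Rightarrow> bool" where
  "qfree (Eql s t) \<longleftrightarrow> True"
| "qfree (Neg \<phi>) \<longleftrightarrow> qfree \<phi>"
| "qfree (Conj \<phi> \<psi>) \<longleftrightarrow> qfree \<phi> \<and> qfree \<psi>"
| "qfree (Exi \<phi>) \<longleftrightarrow> False"

primrec eval_trm :: "('f \<Rightarrow> 'a list \<Rightarrow> 'a) \<Rightarrow> 'a list \<Rightarrow> 'f trm \<Rightarrow> 'a" where
  "eval_trm I v (Var i) = v ! i"
| "eval_trm I v (Fn f ts) = I f (map (eval_trm I v) ts)"

primrec sat :: "('f \<Rightarrow> 'a list \<Rightarrow> 'a) \<Rightarrow> 'a list \<Rightarrow> 'f fm \<Rightarrow> bool" where
  "sat I v (Eql s t) \<longleftrightarrow> eval_trm I v s = eval_trm I v t"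
| "sat I v (Neg \<phi>) \<longleftrightarrow> \<not> sat I v \<phi>"
| "sat I v (Conj \<phi> \<psi>) \<longleftrightarrow> sat I v \<phi> \<and> sat I v \<psi>"
| "sat I v (Exi \<phi>) \<longleftrightarrow> (\<exists>x. sat I (x # v) \<phi>)"

definition tuples :: "nat \<Rightarrow> 'a list set" where
  "tuples m = {v. length v = m}"

text \<open>
  Definability is definability with parameters: \<open>b\<close> is a finite tuple of elements of the structure.
  The parameters cannot be dropped on the quantifier-free side when the functions named by the
  language have coefficients in \<open>k\<close>: in \<open>k \<times> k\<close> with the functions \<open>c * (x1 - x2)\<close> and \<open>x2\<close> (as
  multiples of the unit), \<open>c\<close> transcendental, the set consisting of \<open>c\<close> times the unit is definable
  without parameters, whereas every parameter-free term has integer polynomial values on \<open>k\<close>.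
\<close>

definition definable ::
    "'f set \<Rightarrow> ('f \<Rightarrow> nat) \<Rightarrow> ('f \<Rightarrow> 'a list \<Rightarrow> 'a) \<Rightarrow> nat \<Rightarrow> 'a list set \<Rightarrow> bool" where
  "definable L ar I m X \<longleftrightarrow>
     (\<exists>\<phi> b. wf_fm L ar (m + length b) \<phi> \<and> X = {v \<in> tuples m. sat I (v @ b) \<phi>})"

definition qf_definable ::
    "'f set \<Rightarrow> ('f \<Rightarrow> nat) \<Rightarrow> ('f \<Rightarrow> 'a list \<Rightarrow> 'a) \<Rightarrow> nat \<Rightarrow> 'a list set \<Rightarrow> bool" where
  "qf_definable L ar I m X \<longleftrightarrow>
     (\<exists>\<phi> b. wf_fm L ar (m + length b) \<phi> \<and> qfree \<phi> \<and> X = {v \<in> tuples m. sat I (v @ b) \<phi>})"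

definition admits_QE :: "'f set \<Rightarrow> ('f \<Rightarrow> nat) \<Rightarrow> ('f \<Rightarrow> 'a list \<Rightarrow> 'a) \<Rightarrow> bool" where
  "admits_QE L ar I \<longleftrightarrow> (\<forall>m X. definable L ar I m X \<longrightarrow> qf_definable L ar I m X)"


section \<open>Finite-dimensional algebras and extensions of the ring language\<close>

text \<open>The multiplication need not be associative or commutative.\<close>

locale fd_unital_algebra = vector_space scale
  for scale :: "'k::field \<Rightarrow> 'a::ab_group_add \<Rightarrow> 'a" +
  fixes mul :: "'a \<Rightarrow> 'a \<Rightarrow> 'a" and u :: 'a
  assumes finite_dim: "\<exists>B. finite_dimensional_vector_space scale B"
    and linear_mul_left: "Vector_Spaces.linear scale scale (\<lambda>x. mul x y)"
    and linear_mul_right: "Vector_Spaces.linear scale scale (mul x)"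
    and left_unit: "mul u x = x"
    and right_unit: "mul x u = x"

datatype 'e ring_ext = RZero | ROne | RPlus | RMinus | RTimes | Ext 'e

definition ring_ext_lang :: "'e set \<Rightarrow> 'e ring_ext set" where
  "ring_ext_lang E = {RZero, ROne, RPlus, RMinus, RTimes} \<union> Ext ` E"

primrec ring_ext_arity :: "('e \<Rightarrow> nat) \<Rightarrow> 'e ring_ext \<Rightarrow> nat" where
  "ring_ext_arity ar RZero = 0"
| "ring_ext_arity ar ROne = 0"
| "ring_ext_arity ar RPlus = 2"
| "ring_ext_arity ar RMinus = 2"
| "ring_ext_arity ar RTimes = 2"
| "ring_ext_arity ar (Ext e) = ar e"

primrec ring_ext_interp :: "('a::ab_group_add \<Rightarrow> 'a \<Rightarrow> 'a) \<Rightarrow> 'a \<Rightarrow> ('e \<Rightarrow> 'a list \<Rightarrow> 'a)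
    \<Rightarrow> 'e ring_ext \<Rightarrow> 'a list \<Rightarrow> 'a" where
  "ring_ext_interp mul u IE RZero = (\<lambda>xs. 0)"
| "ring_ext_interp mul u IE ROne = (\<lambda>xs. u)"
| "ring_ext_interp mul u IE RPlus = (\<lambda>xs. xs ! 0 + xs ! 1)"
| "ring_ext_interp mul u IE RMinus = (\<lambda>xs. xs ! 0 - xs ! 1)"
| "ring_ext_interp mul u IE RTimes = (\<lambda>xs. mul (xs ! 0) (xs ! 1))"
| "ring_ext_interp mul u IE (Ext e) = IE e"

definition ring_aut_group :: "('a::ab_group_add \<Rightarrow> 'a \<Rightarrow> 'a) \<Rightarrow> 'a \<Rightarrow> ('a \<Rightarrow> 'a) monoid" where
  "ring_aut_group mul u = \<lparr>
     carrier = {g. bij g \<and> (\<forall>x y. g (x + y) = g x + g y) \<and> (\<forall>x y. g (x - y) = g x - g y) \<and>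
       (\<forall>x y. g (mul x y) = mul (g x) (g y)) \<and> g 0 = 0 \<and> g u = u},
     monoid.mult = (\<circ>), one = id\<rparr>"

definition general_linear :: "('k::field \<Rightarrow> 'a::ab_group_add \<Rightarrow> 'a) \<Rightarrow> ('a \<Rightarrow> 'a) set" where
  "general_linear scale = {g. Vector_Spaces.linear scale scale g \<and> bij g}"


section \<open>Polynomial functions and invariants\<close>

text \<open>
  Functions on a set \<open>X\<close> are represented extensionally (value \<open>undefined\<close> outside \<open>X\<close>), so that
  equality in HOL is equality of functions on \<open>X\<close>. Subalgebras contain the constants.
\<close>

inductive_set subalgebra_gen :: "'x set \<Rightarrow> ('x \<Rightarrow> 'k::field) set \<Rightarrow> ('x \<Rightarrow> 'k) set"
  for X :: "'x set" and S :: "('x \<Rightarrow> 'k::field) set" where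
  const: "(\<lambda>x\<in>X. c) \<in> subalgebra_gen X S"
| gen: "s \<in> S \<Longrightarrow> s \<in> subalgebra_gen X S"
| add: "f \<in> subalgebra_gen X S \<Longrightarrow> g \<in> subalgebra_gen X S \<Longrightarrow> (\<lambda>x\<in>X. f x + g x) \<in> subalgebra_gen X S"
| mul: "f \<in> subalgebra_gen X S \<Longrightarrow> g \<in> subalgebra_gen X S \<Longrightarrow> (\<lambda>x\<in>X. f x * g x) \<in> subalgebra_gen X S"

text \<open>
  The generators below span the dual space of the \<open>m\<close>-th power, since every linear functional
  on it is a sum of linear functionals of the individual entries.
\<close>

definition poly_functions ::
    "('k::field \<Rightarrow> 'a::ab_group_add \<Rightarrow> 'a) \<Rightarrow> nat \<Rightarrow> ('a list \<Rightarrow> 'k) set" where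
  "poly_functions scale m = subalgebra_gen (tuples m)
     {(\<lambda>v\<in>tuples m. l (v ! i)) | l i. i < m \<and> Vector_Spaces.linear scale (*) l}"

definition act :: "nat \<Rightarrow> ('a \<Rightarrow> 'a) \<Rightarrow> ('a list \<Rightarrow> 'k) \<Rightarrow> ('a list \<Rightarrow> 'k)" where
  "act m g f = (\<lambda>v\<in>tuples m. f (map (inv_into UNIV g) v))"

definition invariants ::
    "('k::field \<Rightarrow> 'a::ab_group_add \<Rightarrow> 'a) \<Rightarrow> ('a \<Rightarrow> 'a) set \<Rightarrow> nat \<Rightarrow> ('a list \<Rightarrow> 'k) set" where
  "invariants scale G m = {f \<in> poly_functions scale m. \<forall>g\<in>G. act m g f = f}"

text \<open>Minimality is with respect to inclusion.\<close>

definition minimal_generating_set ::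
    "'x set \<Rightarrow> ('x \<Rightarrow> 'k::field) set \<Rightarrow> ('x \<Rightarrow> 'k) set \<Rightarrow> bool" where
  "minimal_generating_set X R S \<longleftrightarrow>
     S \<subseteq> R \<and> subalgebra_gen X S = R \<and> (\<forall>T. T \<subset> S \<longrightarrow> subalgebra_gen X T \<noteq> R)"

end

theory Submission
  imports Defs
begin

text \<open>
  Over an algebraically closed field, projections of constructible sets are constructible, so every
  definable subset of a power of the algebra is constructible; it is also stable under \<open>G\<close>, because
  \<open>G\<close> acts by automorphisms of the extended structure. Membership in it is decided by which functions
  of a finite set \<open>F\<close> vanish, and up to the action of \<open>G\<close> this pattern can be read off from invariants:
  some point of the orbit of \<open>v\<close> is a common zero of \<open>f\<^sub>0, \<dots>, f\<^sub>r\<close> iff the product over \<open>g \<in> G\<close> of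
  \<open>f\<^sub>0 (g v) + t * f\<^sub>1 (g v) + \<dots> + t ^ r * f\<^sub>r (g v)\<close> vanishes for sufficiently many constants \<open>t\<close>.
  The set is thus a Boolean combination of zero sets of invariants, and invariants are terms in the
  generators, with constants of \<open>k\<close> as parameters.
\<close>

section \<open>Constructible sets\<close>

text \<open>Kept abstract because two algebras occur: all polynomial maps, for eliminating
  quantifiers, and the \<open>G\<close>-invariant ones, for the final formula.\<close>

locale function_algebra =
  fixes R :: "('x \<Rightarrow> 'k::field) set"
  assumes const: "(\<lambda>x. c) \<in> R"
    and add: "f \<in> R \<Longrightarrow> g \<in> R \<Longrightarrow> (\<lambda>x. f x + g x) \<in> R"
    and mult: "f \<in> R \<Longrightarrow> g \<in> R \<Longrightarrow> (\<lambda>x. f x * g x) \<in> R"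
begin

lemma diff:
  assumes "f \<in> R" "g \<in> R"
  shows "(\<lambda>x. f x - g x) \<in> R"
  using add[OF assms(1) mult[OF const[of "-1"] assms(2)]] by simp

lemma sum:
  "finite I \<Longrightarrow> (\<And>i. i \<in> I \<Longrightarrow> f i \<in> R) \<Longrightarrow> (\<lambda>x. \<Sum>i\<in>I. f i x) \<in> R"
  by (induction I rule: finite_induct) (simp_all add: const add)

lemma prod:
  "finite I \<Longrightarrow> (\<And>i. i \<in> I \<Longrightarrow> f i \<in> R) \<Longrightarrow> (\<lambda>x. \<Prod>i\<in>I. f i x) \<in> R"
  by (induction I rule: finite_induct) (simp_all add: const mult)

end

inductive_set constructible :: "('x \<Rightarrow> 'k::zero) set \<Rightarrow> 'x set set"
  for R :: "('x \<Rightarrow> 'k) set" where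
  zero_set: "f \<in> R \<Longrightarrow> {x. f x = 0} \<in> constructible R"
| Compl: "A \<in> constructible R \<Longrightarrow> - A \<in> constructible R"
| Int: "A \<in> constructible R \<Longrightarrow> B \<in> constructible R \<Longrightarrow> A \<inter> B \<in> constructible R"

lemma constructible_Un:
  assumes "A \<in> constructible R" "B \<in> constructible R"
  shows "A \<union> B \<in> constructible R"
proof -
  have "- (- A \<inter> - B) \<in> constructible R"
    using assms by (intro constructible.intros)
  then show ?thesis by simp
qed

lemma constructible_nonzero_set: "f \<in> R \<Longrightarrow> {x. f x \<noteq> 0} \<in> constructible R"
  unfolding Collect_neg_eq by (intro constructible.intros)

text \<open>A Boolean combination involves only finitely many functions, and their vanishing pattern
  settles membership. Working with patterns takes the place of a normal form.\<close>

lemma constructible_depends_finite: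
  assumes "C \<in> constructible R"
  obtains F where "finite F" "F \<subseteq> R"
    "\<forall>x y. (\<forall>f\<in>F. f x = 0 \<longleftrightarrow> f y = 0) \<longrightarrow> (x \<in> C \<longleftrightarrow> y \<in> C)"
  using assms
proof (induction arbitrary: thesis rule: constructible.induct)
  case (zero_set f)
  show ?case by (rule zero_set.prems[of "{f}"]) (use zero_set.hyps in auto)
next
  case (Compl A)
  obtain F where F: "finite F" "F \<subseteq> R"
    "\<forall>x y. (\<forall>f\<in>F. f x = 0 \<longleftrightarrow> f y = 0) \<longrightarrow> (x \<in> A \<longleftrightarrow> y \<in> A)"
    by (rule Compl.IH) (rule that)
  show ?case by (rule Compl.prems[of F]) (use F in simp_all)
next
  case (Int A B)
  obtain F where F: "finite F" "F \<subseteq> R"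
    "\<forall>x y. (\<forall>f\<in>F. f x = 0 \<longleftrightarrow> f y = 0) \<longrightarrow> (x \<in> A \<longleftrightarrow> y \<in> A)"
    by (rule Int.IH(1)) (rule that)
  obtain F' where F': "finite F'" "F' \<subseteq> R"
    "\<forall>x y. (\<forall>f\<in>F'. f x = 0 \<longleftrightarrow> f y = 0) \<longrightarrow> (x \<in> B \<longleftrightarrow> y \<in> B)"
    by (rule Int.IH(2)) (rule that)
  show ?case
  proof (rule Int.prems[of "F \<union> F'"])
    show "\<forall>x y. (\<forall>f \<in> F \<union> F'. f x = 0 \<longleftrightarrow> f y = 0) \<longrightarrow> (x \<in> A \<inter> B \<longleftrightarrow> y \<in> A \<inter> B)"
    proof (intro allI impI)
      fix x y assume "\<forall>f \<in> F \<union> F'. f x = 0 \<longleftrightarrow> f y = 0"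
      then have "x \<in> A \<longleftrightarrow> y \<in> A" "x \<in> B \<longleftrightarrow> y \<in> B"
        using F(3)[rule_format, of x y] F'(3)[rule_format, of x y] by auto
      then show "x \<in> A \<inter> B \<longleftrightarrow> y \<in> A \<inter> B" by simp
    qed
  qed (use F F' in auto)
qed

context function_algebra
begin

lemma constructible_UNIV: "UNIV \<in> constructible R"
  using constructible.zero_set[OF const[of 0]] by simp

lemma constructible_empty: "{} \<in> constructible R"
  using constructible.Compl[OF constructible_UNIV] by simp

lemma constructible_INT:
  "finite I \<Longrightarrow> (\<And>i. i \<in> I \<Longrightarrow> A i \<in> constructible R) \<Longrightarrow> (\<Inter>i\<in>I. A i) \<in> constructible R"
  by (induction I rule: finite_induct) (simp_all add: constructible_UNIV constructible.Int)

lemma constructible_UN: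
  "finite I \<Longrightarrow> (\<And>i. i \<in> I \<Longrightarrow> A i \<in> constructible R) \<Longrightarrow> (\<Union>i\<in>I. A i) \<in> constructible R"
  by (induction I rule: finite_induct) (simp_all add: constructible_empty constructible_Un)

text \<open>Converse of \<open>constructible_depends_finite\<close>: the points with a given pattern
  form a constructible cell, and \<open>D\<close> is the union of the cells that it meets, of which
  there are at most as many as subsets of \<open>F\<close>.\<close>

lemma constructible_if_depends_finite:
  assumes F: "finite F" "F \<subseteq> R"
    and dep: "\<And>x y. {f \<in> F. f x = 0} = {f \<in> F. f y = 0} \<Longrightarrow> x \<in> D \<Longrightarrow> y \<in> D"
  shows "D \<in> constructible R"
proof -
  let ?pat = "\<lambda>x. {f \<in> F. f x = 0}"
  have pat: "{x. ?pat x = P} \<in> constructible R" if "P \<subseteq> F" for P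
  proof -
    have "{x. ?pat x = P} = (\<Inter>f\<in>F. {x. f x = 0 \<longleftrightarrow> f \<in> P})"
      using that by blast
    also have "\<dots> \<in> constructible R"
    proof (rule constructible_INT[OF F(1)])
      fix f assume "f \<in> F"
      then have "f \<in> R" using F(2) by blast
      then show "{x. f x = 0 \<longleftrightarrow> f \<in> P} \<in> constructible R"
        by (cases "f \<in> P") (simp_all add: constructible.zero_set constructible_nonzero_set)
    qed
    finally show ?thesis .
  qed
  have "finite (?pat ` D)"
    by (rule finite_subset[of _ "Pow F"]) (use F(1) in auto)
  then have "(\<Union>P \<in> ?pat ` D. {x. ?pat x = P}) \<in> constructible R"
    by (rule constructible_UN) (rule pat, blast)
  also have "(\<Union>P \<in> ?pat ` D. {x. ?pat x = P}) = D"
  proof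
    show "(\<Union>P \<in> ?pat ` D. {x. ?pat x = P}) \<subseteq> D"
    proof
      fix x assume "x \<in> (\<Union>P \<in> ?pat ` D. {x. ?pat x = P})"
      then obtain y where "y \<in> D" "?pat x = ?pat y" by blast
      then show "x \<in> D" using dep[of y x] by simp
    qed
  qed blast
  finally show ?thesis .
qed

end

section \<open>Elimination of a quantifier over an algebraically closed field\<close>

text \<open>A polynomial whose coefficients vary in \<open>R\<close>; the bound \<open>d\<close> is strict, so that only the zero
  family has bound \<open>0\<close>.\<close>

definition poly_family :: "('x \<Rightarrow> 'k::field) set \<Rightarrow> nat \<Rightarrow> ('x \<Rightarrow> 'k poly) \<Rightarrow> bool" where
  "poly_family R d p \<longleftrightarrow>
     (\<forall>i. (\<lambda>x. coeff (p x) i) \<in> R) \<and> (\<forall>x i. d \<le> i \<longrightarrow> coeff (p x) i = 0)"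

lemma poly_family_0: "poly_family R 0 p \<Longrightarrow> p x = 0"
  by (simp add: poly_family_def poly_eq_iff)

lemma poly_family_degree: "poly_family R (Suc d) p \<Longrightarrow> degree (p x) \<le> d"
  by (auto simp: poly_family_def intro: degree_le)

lemma poly_family_eq_0_iff: "poly_family R d p \<Longrightarrow> p x = 0 \<longleftrightarrow> (\<forall>i<d. coeff (p x) i = 0)"
  by (simp add: poly_family_def poly_eq_iff) (meson not_less)

section \<open>Arithmetic and pseudo-division of polynomial families\<close>

context function_algebra
begin

lemma poly_family_pCons:
  assumes "f \<in> R" "poly_family R d p"
  shows "poly_family R (Suc d) (\<lambda>x. pCons (f x) (p x))"
proof -
  have "(\<lambda>x. coeff (pCons (f x) (p x)) i) \<in> R" for i
    using assms by (cases i) (auto simp: poly_family_def)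
  moreover have "coeff (pCons (f x) (p x)) i = 0" if "Suc d \<le> i" for x i
    using assms that by (cases i) (auto simp: poly_family_def)
  ultimately show ?thesis unfolding poly_family_def by blast
qed

lemma poly_family_const: "f \<in> R \<Longrightarrow> poly_family R 1 (\<lambda>x. [:f x:])"
  using poly_family_pCons[of f 0 "\<lambda>x. 0"] by (simp add: poly_family_def const)

lemma poly_family_add:
  assumes "poly_family R d p" "poly_family R e q"
  shows "poly_family R (max d e) (\<lambda>x. p x + q x)"
  using assms by (auto simp: poly_family_def intro: add)

lemma poly_family_mult:
  assumes p: "poly_family R d p" and q: "poly_family R e q"
  shows "poly_family R (d + e) (\<lambda>x. p x * q x)"
proof -
  have "(\<lambda>x. coeff (p x * q x) i) \<in> R" for i
    unfolding coeff_mult using p q by (intro sum mult) (auto simp: poly_family_def)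
  moreover have "coeff (p x * q x) i = 0" if "d + e \<le> i" for x i
    unfolding coeff_mult
  proof (intro sum.neutral ballI)
    fix j assume "j \<in> {..i}"
    then have "d \<le> j \<or> e \<le> i - j" using that by auto
    then show "coeff (p x) j * coeff (q x) (i - j) = 0"
      using p q by (auto simp: poly_family_def)
  qed
  ultimately show ?thesis unfolding poly_family_def by blast
qed

lemma poly_family_power:
  assumes "poly_family R d p"
  shows "\<exists>e. poly_family R e (\<lambda>x. p x ^ n)"
proof (induction n)
  case 0
  then show ?case using poly_family_const[OF const[of 1]] by (auto simp: one_pCons)
next
  case (Suc n)
  then show ?case using poly_family_mult[OF assms] by auto
qed

lemma poly_family_prod:
  assumes "finite I" "\<And>i. i \<in> I \<Longrightarrow> \<exists>d. poly_family R d (p i)"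
  shows "\<exists>e. poly_family R e (\<lambda>x. \<Prod>i\<in>I. p i x)"
  using assms
proof (induction I rule: finite_induct)
  case empty
  then show ?case using poly_family_const[OF const[of 1]] by (auto simp: one_pCons)
next
  case (insert i I)
  then obtain d e where "poly_family R d (p i)" "poly_family R e (\<lambda>x. \<Prod>i\<in>I. p i x)"
    by blast
  then have "poly_family R (d + e) (\<lambda>x. p i x * (\<Prod>i\<in>I. p i x))"
    by (rule poly_family_mult)
  then show ?case using insert.hyps by auto
qed

text \<open>For use on the locus where the coefficient at \<open>d\<close> vanishes: there the
  polynomial is unchanged, while the bound has dropped by one.\<close>

lemma poly_family_drop_lead:
  assumes "poly_family R (Suc d) p"
  shows "poly_family R d (\<lambda>x. p x - monom (coeff (p x) d) d)"
proof -
  have "(\<lambda>x. coeff (p x - monom (coeff (p x) d) d) i) \<in> R" for i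
    using assms by (cases "i = d") (auto simp: poly_family_def const)
  moreover have "coeff (p x - monom (coeff (p x) d) d) i = 0" if "d \<le> i" for x i
    using assms that by (cases "i = d") (auto simp: poly_family_def)
  ultimately show ?thesis unfolding poly_family_def by blast
qed

text \<open>One step of Euclidean division, multiplied through by the leading coefficient of the
  divisor so that no division occurs and the coefficients stay in \<open>R\<close>. The terms at
  \<open>e\<close> cancel, which lowers the bound.\<close>

lemma poly_family_pseudo_reduce:
  assumes p: "poly_family R (Suc d) p" and q: "poly_family R (Suc e) q" and "d \<le> e"
  shows "poly_family R e
    (\<lambda>x. smult (coeff (p x) d) (q x) - monom (coeff (q x) e) (e - d) * p x)"
    (is "poly_family R e ?r")
proof -
  have coeff: "coeff (?r x) i = coeff (p x) d * coeff (q x) i -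
      (if i < e - d then 0 else coeff (q x) e * coeff (p x) (i - (e - d)))" for x i
    by (simp add: coeff_monom_mult)
  have "(\<lambda>x. coeff (?r x) i) \<in> R" for i
    unfolding coeff using p q
    by (cases "i < e - d") (auto simp: poly_family_def intro!: diff mult const)
  moreover have "coeff (?r x) i = 0" if "e \<le> i" for x i
  proof (cases "i = e")
    case True
    then show ?thesis unfolding coeff using \<open>d \<le> e\<close> by simp
  next
    case False
    then have "Suc e \<le> i" "Suc d \<le> i - (e - d)" using that \<open>d \<le> e\<close> by auto
    then show ?thesis unfolding coeff using p q by (auto simp: poly_family_def)
  qed
  ultimately show ?thesis unfolding poly_family_def by blast
qed

text \<open>The condition on the coefficient at \<open>d\<close> makes \<open>d\<close> the exact
  degree of the divisor and its leading coefficient a unit, so pseudo-reducing the dividend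
  preserves divisibility. Once the dividend has smaller degree, divisibility means that all its
  coefficients vanish.\<close>

lemma constructible_dvd:
  assumes p: "poly_family R (Suc d) p"
  shows "poly_family R e q \<Longrightarrow> {x. coeff (p x) d \<noteq> 0 \<and> p x dvd q x} \<in> constructible R"
proof (induction e arbitrary: q)
  case 0
  have "{x. coeff (p x) d \<noteq> 0 \<and> p x dvd q x} = {x. coeff (p x) d \<noteq> 0}"
    using poly_family_0[OF 0] by auto
  then show ?case using p by (auto simp: poly_family_def intro: constructible_nonzero_set)
next
  case (Suc e)
  show ?case
  proof (cases "d \<le> e")
    case True
    let ?r = "\<lambda>x. smult (coeff (p x) d) (q x) - monom (coeff (q x) e) (e - d) * p x"
    have "p x dvd ?r x \<longleftrightarrow> p x dvd q x" if "coeff (p x) d \<noteq> 0" for x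
      using that by (simp add: dvd_diff_left_iff dvd_smult_iff)
    then have "{x. coeff (p x) d \<noteq> 0 \<and> p x dvd q x} = {x. coeff (p x) d \<noteq> 0 \<and> p x dvd ?r x}"
      by blast
    then show ?thesis using Suc.IH[OF poly_family_pseudo_reduce[OF p Suc.prems True]] by simp
  next
    case False
    have "p x dvd q x \<longleftrightarrow> (\<forall>i<Suc e. coeff (q x) i = 0)" if "coeff (p x) d \<noteq> 0" for x
    proof -
      have "degree (q x) < degree (p x)"
        using poly_family_degree[OF Suc.prems, of x] False le_degree[OF that] by linarith
      then have "p x dvd q x \<longleftrightarrow> q x = 0" using dvd_imp_degree_le[of "p x" "q x"] by auto
      then show ?thesis using poly_family_eq_0_iff[OF Suc.prems] by simp
    qed
    then have "{x. coeff (p x) d \<noteq> 0 \<and> p x dvd q x} =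
        {x. coeff (p x) d \<noteq> 0} \<inter> (\<Inter>i\<in>{..<Suc e}. {x. coeff (q x) i = 0})"
      by auto
    also have "\<dots> \<in> constructible R"
      using p Suc.prems
      by (intro constructible.Int constructible_INT constructible.zero_set constructible_nonzero_set)
        (auto simp: poly_family_def)
    finally show ?thesis .
  qed
qed

end

text \<open>Over an algebraically closed field \<open>p\<close> splits into at most \<open>d\<close>
  linear factors, each of which divides \<open>q\<close> when the roots of \<open>p\<close> are
  roots of \<open>q\<close>; one copy of \<open>q\<close> pays for each factor. The induction
  removes one root at a time.\<close>

lemma roots_subset_iff_dvd_power:
  fixes p q :: "'k::alg_closed_field poly"
  assumes "p \<noteq> 0" "degree p \<le> d"
  shows "(\<forall>t. poly p t = 0 \<longrightarrow> poly q t = 0) \<longleftrightarrow> p dvd q ^ d"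
proof
  assume "p dvd q ^ d"
  then obtain r where r: "q ^ d = p * r" ..
  have "poly q t ^ d = poly p t * poly r t" for t
    by (simp flip: poly_power poly_mult add: r)
  then show "\<forall>t. poly p t = 0 \<longrightarrow> poly q t = 0"
    by (metis mult_zero_left power_eq_0_iff)
next
  show "\<forall>t. poly p t = 0 \<longrightarrow> poly q t = 0 \<Longrightarrow> p dvd q ^ d"
    using assms
  proof (induction d arbitrary: p)
    case 0
    then show ?case by (simp add: is_unit_iff_degree)
  next
    case (Suc d)
    show ?case
    proof (cases "degree p = 0")
      case True
      then have "p dvd 1" using Suc.prems by (simp add: is_unit_iff_degree)
      then show ?thesis by (rule dvd_trans) simp
    next
      case False
      then obtain t where t: "poly p t = 0" using alg_closed_imp_poly_has_root[of p] by auto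
      then obtain r where r: "p = [:-t, 1:] * r" by (auto simp: poly_eq_0_iff_dvd)
      have "[:-t, 1:] dvd q" using Suc.prems(1) t by (simp add: poly_eq_0_iff_dvd)
      moreover have "r dvd q ^ d"
      proof (rule Suc.IH)
        show "r \<noteq> 0" using r Suc.prems by auto
        then show "degree r \<le> d"
          using Suc.prems(3) degree_mult_eq[of "[:-t, 1:]" r] r by simp
        show "\<forall>t. poly r t = 0 \<longrightarrow> poly q t = 0" using Suc.prems(1) r by auto
      qed
      ultimately show ?thesis unfolding r power_Suc by (rule mult_dvd_mono)
    qed
  qed
qed

section \<open>Elimination of one scalar quantifier\<close>

locale function_algebra_acf = function_algebra R
  for R :: "('x \<Rightarrow> 'k::{alg_closed_field, field_char_0}) set"
begin

text \<open>A parametric Euclidean algorithm: two equations are reduced against each other until at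
  most one is left, and that case is a question of divisibility. The number of equations is part of
  the measure so that discarding a zero polynomial of bound \<open>0\<close> counts as
  progress.\<close>

lemma constructible_ex_root:
  assumes "\<And>d p. (d, p) \<in> set ps \<Longrightarrow> poly_family R d p" and q: "poly_family R e q"
  shows "{x. \<exists>t. (\<forall>(d, p) \<in> set ps. poly (p x) t = 0) \<and> poly (q x) t \<noteq> 0} \<in> constructible R"
    (is "?S ps \<in> _")
  using assms(1)
proof (induction "sum_list (map fst ps) + length ps" arbitrary: ps rule: less_induct)
  case less
  have lead: "(\<lambda>x. coeff (p x) i) \<in> R" if "poly_family R d p" for p d i
    using that by (simp add: poly_family_def)
  \<comment> \<open>Only the set of equations matters for \<open>?S\<close>, so this form serves
    both orders of the first two equations; the measure is tracked separately because the set does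
    not determine it.\<close>
  have two: "?S ps \<in> constructible R"
    if set: "set ps = set ((d1, p1) # (d2, p2) # qs)" and "d2 \<le> d1"
      and size: "sum_list (map fst ps) + length ps = d1 + d2 + sum_list (map fst qs) + length qs + 2"
    for d1 p1 d2 p2 qs
  proof -
    have S: "?S ps = ?S ((d1, p1) # (d2, p2) # qs)" using set by simp
    have fam: "poly_family R d1 p1" "poly_family R d2 p2"
      "\<And>d p. (d, p) \<in> set qs \<Longrightarrow> poly_family R d p"
      using less.prems set by auto
    show ?thesis
    proof (cases d2)
      case 0
      have "?S ps = ?S ((d1, p1) # qs)" unfolding S using fam(2) 0 poly_family_0[of R p2] by auto
      also have "\<dots> \<in> constructible R"
        by (rule less.hyps) (use size fam in auto)
      finally show ?thesis .
    next
      case (Suc d)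
      then obtain d' where d': "d1 = Suc d'" "d \<le> d'" using \<open>d2 \<le> d1\<close> by (cases d1) auto
      let ?c = "\<lambda>x. coeff (p2 x) d"
      let ?r = "\<lambda>x. smult (?c x) (p1 x) - monom (coeff (p1 x) d') (d' - d) * p2 x"
      let ?s = "\<lambda>x. p2 x - monom (coeff (p2 x) d) d"
      \<comment> \<open>Where the leading coefficient of \<open>p2\<close> vanishes, that term is
        dropped; elsewhere \<open>p1\<close> may be replaced by its pseudo-remainder, since this
        keeps the common roots with \<open>p2\<close>. Either way one bound decreases.\<close>
      have "?S ps = ({x. ?c x = 0} \<inter> ?S ((d1, p1) # (d, ?s) # qs)) \<union>
          ({x. ?c x \<noteq> 0} \<inter> ?S ((d', ?r) # (d2, p2) # qs))" (is "_ = ?T")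
      proof (rule Set.set_eqI)
        fix x
        show "x \<in> ?S ps \<longleftrightarrow> x \<in> ?T"
        proof (cases "?c x = 0")
          case False
          then have "poly (?r x) t = 0 \<and> poly (p2 x) t = 0 \<longleftrightarrow> poly (p1 x) t = 0 \<and> poly (p2 x) t = 0"
            for t by auto
          then show ?thesis unfolding S using False by (simp flip: conj_assoc)
        qed (auto simp: S)
      qed
      moreover have "?S ((d1, p1) # (d, ?s) # qs) \<in> constructible R"
        by (rule less.hyps) (use size fam Suc poly_family_drop_lead[of d p2] in auto)
      moreover have "?S ((d', ?r) # (d2, p2) # qs) \<in> constructible R"
        by (rule less.hyps) (use size fam Suc d' poly_family_pseudo_reduce[of d p2 d' p1] in auto)
      ultimately show ?thesis
        using lead[OF fam(2)]
        by (auto intro!: constructible_Un constructible.Int constructible.zero_set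
            constructible_nonzero_set)
    qed
  qed
  consider "ps = []" | d p where "ps = [(d, p)]"
    | d1 p1 d2 p2 qs where "ps = (d1, p1) # (d2, p2) # qs"
    by (metis list.exhaust surj_pair)
  then show ?case
  proof cases
    case 1
    \<comment> \<open>The field is infinite, so without equations a suitable \<open>t\<close> exists
      unless \<open>q x\<close> is the zero polynomial.\<close>
    have "(\<forall>t. poly (q x) t = 0) \<longleftrightarrow> (\<forall>i<e. coeff (q x) i = 0)" for x
      using poly_family_eq_0_iff[OF q] poly_all_0_iff_0[of "q x"] by simp
    then have "?S ps = - (\<Inter>i\<in>{..<e}. {x. coeff (q x) i = 0})" using 1 by auto
    also have "\<dots> \<in> constructible R"
      using lead[OF q]
      by (intro constructible.Compl constructible_INT constructible.zero_set) auto
    finally show ?thesis .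
  next
    case 2
    then have p: "poly_family R d p" using less.prems by simp
    show ?thesis
    proof (cases d)
      case 0
      then have "?S ps = ?S []" using poly_family_0[of R p] p 2 by auto
      also have "\<dots> \<in> constructible R" by (rule less.hyps) (use 2 in auto)
      finally show ?thesis .
    next
      case (Suc d')
      let ?c = "\<lambda>x. coeff (p x) d'"
      let ?s = "\<lambda>x. p x - monom (coeff (p x) d') d'"
      have fam: "poly_family R (Suc d') p" using p Suc by simp
      \<comment> \<open>A root of \<open>p x\<close> that is not a root of \<open>q x\<close>
        refutes the inclusion of roots, which is divisibility of a power with exponent independent
        of \<open>x\<close>.\<close>
      have dvd: "(\<exists>t. poly (p x) t = 0 \<and> poly (q x) t \<noteq> 0) \<longleftrightarrow> \<not> p x dvd q x ^ d'"
        if "?c x \<noteq> 0" for x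
        using roots_subset_iff_dvd_power[of "p x" d' "q x"] that poly_family_degree[OF fam, of x]
        by force
      have "?S ps = ({x. ?c x = 0} \<inter> ?S [(d', ?s)]) \<union>
          ({x. ?c x \<noteq> 0} \<inter> - {x. ?c x \<noteq> 0 \<and> p x dvd q x ^ d'})"
        using dvd 2 by auto
      moreover have "?S [(d', ?s)] \<in> constructible R"
        by (rule less.hyps) (use 2 Suc poly_family_drop_lead[OF fam] in auto)
      moreover obtain e' where "poly_family R e' (\<lambda>x. q x ^ d')"
        using poly_family_power[OF q] by blast
      ultimately show ?thesis
        using lead[OF p] constructible_dvd[OF fam]
        by (auto intro!: constructible_Un constructible.Int constructible.zero_set
            constructible_nonzero_set constructible.Compl)
    qed
  next
    case 3
    show ?thesis
    proof (cases "d2 \<le> d1")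
      case True
      show ?thesis by (rule two[of d1 p1 d2 p2 qs]) (use 3 True in auto)
    next
      case False
      show ?thesis by (rule two[of d2 p2 d1 p1 qs]) (use 3 False in auto)
    qed
  qed
qed

text \<open>Along the curve each function of \<open>R\<close> becomes a polynomial in
  \<open>t\<close> with coefficients in \<open>R\<close>. Asking for a given vanishing pattern at
  some \<open>t\<close> is then an instance of \<open>constructible_ex_root\<close>, and only
  finitely many patterns occur in \<open>C\<close>.\<close>

lemma constructible_ex_along_curve:
  assumes curve: "\<And>f. f \<in> R \<Longrightarrow> \<exists>d p. poly_family R d p \<and> (\<forall>x t. f (\<tau> t x) = poly (p x) t)"
    and C: "C \<in> constructible R"
  shows "{x. \<exists>t. \<tau> t x \<in> C} \<in> constructible R"
proof -
  obtain F where F: "finite F" "F \<subseteq> R"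
    "\<forall>x y. (\<forall>f\<in>F. f x = 0 \<longleftrightarrow> f y = 0) \<longrightarrow> (x \<in> C \<longleftrightarrow> y \<in> C)"
    by (rule constructible_depends_finite[OF C]) (rule that)
  obtain D p where Dp: "\<And>f. f \<in> R \<Longrightarrow> poly_family R (D f) (p f)"
    "\<And>f x t. f \<in> R \<Longrightarrow> f (\<tau> t x) = poly (p f x) t"
    using curve by metis
  let ?pat = "\<lambda>x. {f \<in> F. f x = 0}"
  have pat: "{x. \<exists>t. ?pat (\<tau> t x) = P} \<in> constructible R" if P: "P \<subseteq> F" for P
  proof -
    obtain fs where fs: "set fs = P"
      using finite_list[of P] finite_subset[OF P F(1)] by blast
    \<comment> \<open>All functions outside \<open>P\<close> are nonzero iff their product is, so
      one inequation suffices.\<close>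
    let ?ps = "map (\<lambda>f. (D f, p f)) fs" and ?q = "\<lambda>x. \<Prod>f \<in> F - P. p f x"
    obtain e where "poly_family R e ?q"
      using poly_family_prod[of "F - P" p] F Dp(1) by blast
    then have "{x. \<exists>t. (\<forall>(d, p) \<in> set ?ps. poly (p x) t = 0) \<and> poly (?q x) t \<noteq> 0}
        \<in> constructible R"
      using F(2) P fs Dp(1) by (intro constructible_ex_root) auto
    moreover have "?pat (\<tau> t x) = P \<longleftrightarrow>
        (\<forall>(d, p) \<in> set ?ps. poly (p x) t = 0) \<and> poly (?q x) t \<noteq> 0" for x t
    proof -
      have "?pat (\<tau> t x) = {f \<in> F. poly (p f x) t = 0}"
        using Dp(2) F(2) by auto
      then show ?thesis using F(1) fs P by (auto simp: poly_prod)
    qed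
    ultimately show ?thesis by simp
  qed
  have "\<tau> t x \<in> C \<longleftrightarrow> ?pat (\<tau> t x) \<in> ?pat ` C" for t x
  proof
    assume "?pat (\<tau> t x) \<in> ?pat ` C"
    then obtain y where "y \<in> C" "?pat (\<tau> t x) = ?pat y" by auto
    then show "\<tau> t x \<in> C" using F(3)[rule_format, of "\<tau> t x" y] by blast
  qed auto
  then have "{x. \<exists>t. \<tau> t x \<in> C} = (\<Union>P \<in> ?pat ` C. {x. \<exists>t. ?pat (\<tau> t x) = P})"
    by auto
  moreover have "finite (?pat ` C)"
    by (rule finite_subset[of _ "Pow F"]) (use F(1) in auto)
  moreover have "P \<subseteq> F" if "P \<in> ?pat ` C" for P
    using that by auto
  ultimately show ?thesis
    using constructible_UN[of "?pat ` C" "\<lambda>P. {x. \<exists>t. ?pat (\<tau> t x) = P}"] pat by simp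
qed

end

section \<open>Definable sets of the algebra are constructible\<close>

lemma constructible_vimage:
  assumes "C \<in> constructible R" "\<And>f. f \<in> R \<Longrightarrow> (\<lambda>x. f (h x)) \<in> R'"
  shows "{x. h x \<in> C} \<in> constructible R'"
  using assms(1)
proof (induction rule: constructible.induct)
  case (zero_set f)
  then show ?case using assms(2) by (simp add: constructible.zero_set)
next
  case (Compl A)
  then show ?case using constructible.Compl[of "{x. h x \<in> A}"] by (simp add: Collect_neg_eq)
next
  case (Int A B)
  then show ?case
    using constructible.Int[of "{x. h x \<in> A}" R' "{x. h x \<in> B}"] by (simp add: Collect_conj_eq)
qed

text \<open>Points are infinite sequences, so that no case distinction on the length of a list is needed;
  the elements of \<open>poly_maps scale n\<close> depend on the first \<open>n\<close> entries only.\<close>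

inductive_set poly_maps ::
    "('k::field \<Rightarrow> 'a::ab_group_add \<Rightarrow> 'a) \<Rightarrow> nat \<Rightarrow> ((nat \<Rightarrow> 'a) \<Rightarrow> 'k) set"
  for scale :: "'k::field \<Rightarrow> 'a::ab_group_add \<Rightarrow> 'a" and n :: nat where
  const: "(\<lambda>v. c) \<in> poly_maps scale n"
| coord: "i < n \<Longrightarrow> Vector_Spaces.linear scale (*) l \<Longrightarrow> (\<lambda>v. l (v i)) \<in> poly_maps scale n"
| add: "f \<in> poly_maps scale n \<Longrightarrow> g \<in> poly_maps scale n \<Longrightarrow> (\<lambda>v. f v + g v) \<in> poly_maps scale n"
| mult: "f \<in> poly_maps scale n \<Longrightarrow> g \<in> poly_maps scale n \<Longrightarrow> (\<lambda>v. f v * g v) \<in> poly_maps scale n"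

interpretation pm: function_algebra "poly_maps scale n"
  by unfold_locales (rule poly_maps.intros; assumption)+

interpretation pmc: function_algebra_acf
  "poly_maps (scale :: 'k::{alg_closed_field, field_char_0} \<Rightarrow> 'a::ab_group_add \<Rightarrow> 'a) n"
  by unfold_locales

lemma poly_maps_cong:
  "f \<in> poly_maps scale n \<Longrightarrow> (\<And>i. i < n \<Longrightarrow> v i = w i) \<Longrightarrow> f v = f w"
  by (induction rule: poly_maps.induct) auto

lemma poly_maps_subst:
  assumes "f \<in> poly_maps scale m"
    and "\<And>i l. i < m \<Longrightarrow> Vector_Spaces.linear scale (*) l \<Longrightarrow> (\<lambda>v. l (h v i)) \<in> poly_maps scale n"
  shows "(\<lambda>v. f (h v)) \<in> poly_maps scale n"
  using assms(1)
proof (induction rule: poly_maps.induct)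
  case (coord i l)
  then show ?case by (rule assms(2))
qed (rule poly_maps.intros; assumption)+

lemma poly_maps_imp_poly_functions:
  "f \<in> poly_maps scale n \<Longrightarrow> (\<lambda>v\<in>tuples n. f ((!) v)) \<in> poly_functions scale n"
proof (induction rule: poly_maps.induct)
  case (const c)
  then show ?case unfolding poly_functions_def by (rule subalgebra_gen.const)
next
  case (coord i l)
  then show ?case unfolding poly_functions_def by (intro subalgebra_gen.gen) blast
next
  case (add f g)
  show ?case
    using subalgebra_gen.add[OF add.IH[unfolded poly_functions_def]]
    unfolding poly_functions_def
    by (simp del: restrict_apply add: restrict_apply' cong: restrict_cong)
next
  case (mult f g)
  show ?case
    using subalgebra_gen.mul[OF mult.IH[unfolded poly_functions_def]]
    unfolding poly_functions_def
    by (simp del: restrict_apply add: restrict_apply' cong: restrict_cong)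
qed

text \<open>Bridge from extensional functions on lists to \<open>poly_maps\<close>: polynomial
  functions are generated by functionals of the entries, so it is enough to treat these after the
  substitution.\<close>

lemma poly_functions_subst:
  assumes "p \<in> poly_functions scale m" and "\<And>v. v \<in> X \<Longrightarrow> h v \<in> tuples m"
    and "\<And>i l. i < m \<Longrightarrow> Vector_Spaces.linear scale (*) l \<Longrightarrow>
      \<exists>f \<in> poly_maps scale n. \<forall>v\<in>X. l (h v ! i) = f ((!) v)"
  shows "\<exists>f \<in> poly_maps scale n. \<forall>v\<in>X. p (h v) = f ((!) v)"
  using assms(1) unfolding poly_functions_def
proof (induction rule: subalgebra_gen.induct)
  case (const c)
  then show ?case using assms(2) by (intro bexI[OF _ poly_maps.const]) auto
next
  case (gen s)
  then obtain l i where l: "s = (\<lambda>v\<in>tuples m. l (v ! i))" "i < m" "Vector_Spaces.linear scale (*) l"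
    by blast
  then show ?case using assms(2) assms(3)[of i l] by simp
next
  case (add f g)
  then obtain f' g' where "f' \<in> poly_maps scale n" "g' \<in> poly_maps scale n"
    "\<forall>v\<in>X. f (h v) = f' ((!) v)" "\<forall>v\<in>X. g (h v) = g' ((!) v)" by blast
  then show ?case using assms(2) by (intro bexI[OF _ poly_maps.add[of f' _ _ g']]) auto
next
  case (mul f g)
  then obtain f' g' where "f' \<in> poly_maps scale n" "g' \<in> poly_maps scale n"
    "\<forall>v\<in>X. f (h v) = f' ((!) v)" "\<forall>v\<in>X. g (h v) = g' ((!) v)" by blast
  then show ?case using assms(2) by (intro bexI[OF _ poly_maps.mult[of f' _ _ g']]) auto
qed

section \<open>Elimination of a quantifier over the algebra\<close>

locale fd_unital_algebra_acf = fd_unital_algebra scale mul u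
  for scale :: "'k::{alg_closed_field, field_char_0} \<Rightarrow> 'a::ab_group_add \<Rightarrow> 'a"
    and mul :: "'a \<Rightarrow> 'a \<Rightarrow> 'a" and u :: 'a
begin

text \<open>Linearity is stated for every \<open>b\<close>, also outside \<open>B\<close>, so that
  polynomials for the coordinates can be chosen below without a side condition on
  \<open>b\<close>.\<close>

lemma coordinates:
  obtains B and c :: "'a \<Rightarrow> 'a \<Rightarrow> 'k" where "finite B" "span B = UNIV"
    "\<And>b. Vector_Spaces.linear scale (*) (\<lambda>x. c x b)"
    "\<And>x. x = (\<Sum>b\<in>B. scale (c x b) b)"
proof -
  obtain B where "finite_dimensional_vector_space scale B" using finite_dim ..
  then interpret B: finite_dimensional_vector_space scale B .
  have "vector_space ((*) :: 'k \<Rightarrow> 'k \<Rightarrow> 'k)"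
    by unfold_locales (simp_all add: algebra_simps)
  then have "Vector_Spaces.linear scale (*) (\<lambda>x. representation B x b)" for b
    unfolding Vector_Spaces.linear_iff
    by (simp add: vector_space_axioms representation_add representation_scale
        B.independent_Basis B.span_Basis)
  moreover have "x = (\<Sum>b\<in>B. scale (representation B x b) b)" for x
    by (rule sum_representation_eq[symmetric])
      (simp_all add: B.independent_Basis B.span_Basis B.finite_Basis)
  ultimately show ?thesis using that B.finite_Basis B.span_Basis by blast
qed

lemma functional_add: "Vector_Spaces.linear scale (*) l \<Longrightarrow> l (x + y) = l x + l y"
  and functional_scale: "Vector_Spaces.linear scale (*) l \<Longrightarrow> l (scale a x) = a * l x"
  by (simp_all add: Vector_Spaces.linear_iff)

lemma functional_0: "Vector_Spaces.linear scale (*) l \<Longrightarrow> l 0 = 0"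
  using functional_scale[of l 0 0] by simp

lemma functional_diff: "Vector_Spaces.linear scale (*) l \<Longrightarrow> l (x - y) = l x - l y"
  using functional_add[of l "x - y" y] by simp

lemma functional_sum: "Vector_Spaces.linear scale (*) l \<Longrightarrow> l (sum h I) = (\<Sum>i\<in>I. l (h i))"
  by (induction I rule: infinite_finite_induct) (simp_all add: functional_0 functional_add)

text \<open>A functional of entry \<open>0\<close> is affine in \<open>t\<close> on a line and the
  other entries are constant there; sums and products of polynomials in \<open>t\<close> do the
  rest.\<close>

lemma poly_maps_line:
  assumes "f \<in> poly_maps scale n"
  shows "\<exists>d p. poly_family (poly_maps scale n) d p \<and>
    (\<forall>v t. f (v(0 := v 0 + scale t b)) = poly (p v) t)"
  using assms
proof (induction rule: poly_maps.induct)
  case (const c)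
  show ?case
    using pm.poly_family_const[OF poly_maps.const[of c]] by fastforce
next
  case (coord i l)
  show ?case
  proof (cases "i = 0")
    case True
    have "poly_family (poly_maps scale n) (Suc 1) (\<lambda>v. [:l (v 0), l b:])"
      using coord True
      by (intro pm.poly_family_pCons pm.poly_family_const poly_maps.intros) auto
    moreover have "l ((v(0 := v 0 + scale t b)) i) = poly [:l (v 0), l b:] t" for v t
      using True coord(2) by (simp add: functional_add functional_scale)
    ultimately show ?thesis by blast
  next
    case False
    have "poly_family (poly_maps scale n) 1 (\<lambda>v. [:l (v i):])"
      using coord by (intro pm.poly_family_const poly_maps.intros)
    moreover have "l ((v(0 := v 0 + scale t b)) i) = poly [:l (v i):] t" for v t
      using False by simp
    ultimately show ?thesis by blast
  qed
next
  case (add f g)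
  then obtain d p e q where "poly_family (poly_maps scale n) d p" "poly_family (poly_maps scale n) e q"
    and eq: "\<forall>v t. f (v(0 := v 0 + scale t b)) = poly (p v) t"
      "\<forall>v t. g (v(0 := v 0 + scale t b)) = poly (q v) t" by blast
  then have "poly_family (poly_maps scale n) (max d e) (\<lambda>v. p v + q v)"
    by (intro pm.poly_family_add)
  moreover have "f (v(0 := v 0 + scale t b)) + g (v(0 := v 0 + scale t b)) = poly (p v + q v) t" for v t
    using eq by simp
  ultimately show ?case by blast
next
  case (mult f g)
  then obtain d p e q where "poly_family (poly_maps scale n) d p" "poly_family (poly_maps scale n) e q"
    and eq: "\<forall>v t. f (v(0 := v 0 + scale t b)) = poly (p v) t"
      "\<forall>v t. g (v(0 := v 0 + scale t b)) = poly (q v) t" by blast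
  then have "poly_family (poly_maps scale n) (d + e) (\<lambda>v. p v * q v)"
    by (intro pm.poly_family_mult)
  moreover have "f (v(0 := v 0 + scale t b)) * g (v(0 := v 0 + scale t b)) = poly (p v * q v) t" for v t
    using eq by simp
  ultimately show ?case by blast
qed

text \<open>A quantifier over the span of \<open>B\<close> is a succession of scalar quantifiers,
  one for each vector of \<open>B\<close>. Translating entry \<open>0\<close> instead of replacing
  it lets these quantifiers be added one by one.\<close>

lemma constructible_ex_span:
  assumes "finite B" "C \<in> constructible (poly_maps scale n)"
  shows "{v. \<exists>x \<in> span B. v(0 := v 0 + x) \<in> C} \<in> constructible (poly_maps scale n)"
  using assms(1)
proof (induction B rule: finite_induct)
  case empty
  then show ?case using assms(2) by simp
next
  case (insert b B)
  let ?A = "{v. \<exists>x \<in> span B. v(0 := v 0 + x) \<in> C}"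
  have "{v. \<exists>t. v(0 := v 0 + scale t b) \<in> ?A} \<in> constructible (poly_maps scale n)"
    by (rule pmc.constructible_ex_along_curve[OF poly_maps_line insert.IH])
  also have "{v. \<exists>t. v(0 := v 0 + scale t b) \<in> ?A} =
      {v. \<exists>x \<in> span (insert b B). v(0 := v 0 + x) \<in> C}"
  proof (intro Collect_cong iffI)
    fix v assume "\<exists>t. v(0 := v 0 + scale t b) \<in> ?A"
    then obtain t x where "x \<in> span B" "v(0 := v 0 + (scale t b + x)) \<in> C"
      by (auto simp: add.assoc)
    then show "\<exists>x \<in> span (insert b B). v(0 := v 0 + x) \<in> C"
      by (intro bexI[of _ "scale t b + x"]) (auto simp: span_insert intro: exI[of _ t])
  next
    fix v assume "\<exists>x \<in> span (insert b B). v(0 := v 0 + x) \<in> C"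
    then obtain x t where "x - scale t b \<in> span B" "v(0 := v 0 + x) \<in> C"
      by (auto simp: span_insert)
    then show "\<exists>t. v(0 := v 0 + scale t b) \<in> ?A"
      by (intro exI[of _ t] CollectI bexI[of _ "x - scale t b"]) simp_all
  qed
  finally show ?case .
qed

lemma constructible_ex:
  assumes C: "C \<in> constructible (poly_maps scale (Suc n))"
  shows "{v. \<exists>x. case_nat x v \<in> C} \<in> constructible (poly_maps scale n)"
proof -
  obtain B where B: "finite B" "span B = UNIV" using coordinates by metis
  have "{v. \<exists>x. v(0 := v 0 + x) \<in> C} \<in> constructible (poly_maps scale (Suc n))"
    using constructible_ex_span[OF B(1) C] B(2) by simp
  \<comment> \<open>Starting the translation at \<open>0\<close> turns it into an arbitrary choice
    of entry \<open>0\<close>; functionals of that entry become constants, which leaves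
    \<open>n\<close> variables.\<close>
  then have "{v. case_nat 0 v \<in> {v. \<exists>x. v(0 := v 0 + x) \<in> C}} \<in> constructible (poly_maps scale n)"
  proof (rule constructible_vimage)
    fix f assume "f \<in> poly_maps scale (Suc n)"
    then show "(\<lambda>v. f (case_nat 0 v)) \<in> poly_maps scale n"
    proof (rule poly_maps_subst)
      fix i l assume "i < Suc n" "Vector_Spaces.linear scale (*) l"
      then show "(\<lambda>v. l (case_nat 0 v i)) \<in> poly_maps scale n"
        by (cases i) (simp_all add: poly_maps.const poly_maps.coord)
    qed
  qed
  moreover have "(case_nat 0 v)(0 := case_nat 0 v 0 + x) = case_nat x v" for v and x :: 'a
    by (auto simp: fun_eq_iff split: nat.split)
  ultimately show ?thesis by simp
qed

end

section \<open>Terms and formulas as polynomial conditions\<close>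

locale poly_extension = fd_unital_algebra_acf scale mul u
  for scale :: "'k::{alg_closed_field, field_char_0} \<Rightarrow> 'a::ab_group_add \<Rightarrow> 'a"
    and mul :: "'a \<Rightarrow> 'a \<Rightarrow> 'a" and u :: 'a +
  fixes E :: "'e set" and ar :: "'e \<Rightarrow> nat" and IE :: "'e \<Rightarrow> 'a list \<Rightarrow> 'a"
  assumes E_poly: "e \<in> E \<Longrightarrow>
    \<exists>p \<in> poly_functions scale (ar e). \<forall>a \<in> tuples (ar e). IE e a = scale (p a) u"
begin

abbreviation "lang \<equiv> ring_ext_lang E"
abbreviation "arity \<equiv> ring_ext_arity ar"
abbreviation "interp \<equiv> ring_ext_interp mul u IE"

text \<open>The functional has to vary in the induction: a functional of a product involves all
  coordinates of both factors.\<close>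

lemma functional_eval_trm:
  assumes "wf_trm lang arity n t" "Vector_Spaces.linear scale (*) l"
  shows "\<exists>f \<in> poly_maps scale n. \<forall>v \<in> tuples n. l (eval_trm interp v t) = f ((!) v)"
  using assms
proof (induction t arbitrary: l)
  case (Var i)
  then show ?case by (intro bexI[OF _ poly_maps.coord[of i _ _ l]]) auto
next
  case (Fn f ts)
  note l = Fn.prems(2)
  have len: "length ts = arity f" and f: "f \<in> lang" using Fn.prems(1) by auto
  have sub: "\<exists>f \<in> poly_maps scale n. \<forall>v \<in> tuples n. l (eval_trm interp v (ts ! i)) = f ((!) v)"
    if "i < arity f" "Vector_Spaces.linear scale (*) l" for i l
    using that Fn.prems(1) len by (intro Fn.IH) auto
  show ?case
  proof (cases f)
    case RZero
    then show ?thesis using l by (intro bexI[OF _ poly_maps.const[of 0]]) (simp add: functional_0)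
  next
    case ROne
    then show ?thesis by (intro bexI[OF _ poly_maps.const[of "l u"]]) simp
  next
    case RPlus
    then obtain f0 f1 where "f0 \<in> poly_maps scale n" "f1 \<in> poly_maps scale n"
      "\<forall>v\<in>tuples n. l (eval_trm interp v (ts ! 0)) = f0 ((!) v)"
      "\<forall>v\<in>tuples n. l (eval_trm interp v (ts ! 1)) = f1 ((!) v)"
      using sub[of 0 l] sub[of 1 l] l by auto
    then show ?thesis using RPlus l len
      by (intro bexI[OF _ poly_maps.add[of f0 _ _ f1]]) (auto simp: functional_add)
  next
    case RMinus
    then obtain f0 f1 where "f0 \<in> poly_maps scale n" "f1 \<in> poly_maps scale n"
      "\<forall>v\<in>tuples n. l (eval_trm interp v (ts ! 0)) = f0 ((!) v)"
      "\<forall>v\<in>tuples n. l (eval_trm interp v (ts ! 1)) = f1 ((!) v)"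
      using sub[of 0 l] sub[of 1 l] l by auto
    then show ?thesis using RMinus l len
      by (intro bexI[OF _ pm.diff[of f0 _ _ f1]]) (auto simp: functional_diff)
  next
    case RTimes
    obtain B and c :: "'a \<Rightarrow> 'a \<Rightarrow> 'k" where B: "finite B"
      "\<And>b. Vector_Spaces.linear scale (*) (\<lambda>x. c x b)" "\<And>x. x = (\<Sum>b\<in>B. scale (c x b) b)"
      using coordinates by metis
    have expand: "l' x = (\<Sum>b\<in>B. c x b * l' b)" if "Vector_Spaces.linear scale (*) l'" for l' x
      by (subst B(3)[of x]) (simp add: functional_sum functional_scale that)
    have left: "Vector_Spaces.linear scale (*) (\<lambda>x. l (mul x y))"
      and right: "Vector_Spaces.linear scale (*) (\<lambda>y. l (mul x y))" for x y
      using linear_mul_left[of y] linear_mul_right[of x] l by (simp_all add: Vector_Spaces.linear_iff)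
    \<comment> \<open>Bilinearity makes this a quadratic polynomial in the coordinates, whose
      coefficients are the structure constants seen through \<open>l\<close>.\<close>
    have mul: "l (mul x y) = (\<Sum>b\<in>B. \<Sum>b'\<in>B. c x b * (c y b' * l (mul b b')))" for x y
    proof -
      have "l (mul x y) = (\<Sum>b\<in>B. c x b * l (mul b y))" by (rule expand[OF left])
      also have "\<dots> = (\<Sum>b\<in>B. c x b * (\<Sum>b'\<in>B. c y b' * l (mul b b')))"
        by (intro sum.cong refl arg_cong2[of _ _ _ _ "(*)"] expand[OF right])
      finally show ?thesis by (simp add: sum_distrib_left)
    qed
    obtain f0 f1 where f: "\<And>b. f0 b \<in> poly_maps scale n" "\<And>b. f1 b \<in> poly_maps scale n"
      "\<And>b v. v \<in> tuples n \<Longrightarrow> c (eval_trm interp v (ts ! 0)) b = f0 b ((!) v)"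
      "\<And>b v. v \<in> tuples n \<Longrightarrow> c (eval_trm interp v (ts ! 1)) b = f1 b ((!) v)"
      using sub[OF _ B(2), of 0] sub[OF _ B(2), of 1] RTimes by simp metis
    let ?q = "\<lambda>v. \<Sum>b\<in>B. \<Sum>b'\<in>B. f0 b v * (f1 b' v * l (mul b b'))"
    have "l (eval_trm interp v (Fn f ts)) = ?q ((!) v)" if "v \<in> tuples n" for v
    proof -
      have "l (eval_trm interp v (Fn f ts)) =
          l (mul (eval_trm interp v (ts ! 0)) (eval_trm interp v (ts ! 1)))"
        using RTimes len by simp
      also note mul
      finally show ?thesis by (simp only: f(3,4)[OF that])
    qed
    moreover have "?q \<in> poly_maps scale n"
      by (intro pm.sum B(1) poly_maps.mult poly_maps.const f)
    ultimately show ?thesis by (intro bexI[of _ ?q]) auto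
  next
    case (Ext e)
    then have "e \<in> E" using f by (auto simp: ring_ext_lang_def)
    then obtain p where p: "p \<in> poly_functions scale (ar e)"
      "\<forall>a \<in> tuples (ar e). IE e a = scale (p a) u" using E_poly by blast
    let ?h = "\<lambda>v. map (eval_trm interp v) ts"
    have h: "?h v \<in> tuples (ar e)" for v using len Ext by (simp add: tuples_def)
    have "\<exists>f \<in> poly_maps scale n. \<forall>v \<in> tuples n. p (?h v) = f ((!) v)"
      using p(1) h
    proof (rule poly_functions_subst)
      fix i l assume "i < ar e" "Vector_Spaces.linear scale (*) l"
      then show "\<exists>f \<in> poly_maps scale n. \<forall>v \<in> tuples n. l (?h v ! i) = f ((!) v)"
        using sub[of i l] Ext len by simp
    qed
    then obtain f where "f \<in> poly_maps scale n" "\<forall>v \<in> tuples n. p (?h v) = f ((!) v)" ..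
    then show ?thesis using Ext h p(2) l
      by (intro bexI[OF _ poly_maps.mult[OF _ poly_maps.const[of "l u"], of f]])
        (auto simp: functional_scale)
  qed
qed

theorem definable_constructible:
  assumes "wf_fm lang arity n \<phi>"
  shows "\<exists>C \<in> constructible (poly_maps scale n). \<forall>v \<in> tuples n. sat interp v \<phi> \<longleftrightarrow> (!) v \<in> C"
  using assms
proof (induction \<phi> arbitrary: n)
  case (Eql s t)
  obtain B and c :: "'a \<Rightarrow> 'a \<Rightarrow> 'k" where B: "finite B"
    "\<And>b. Vector_Spaces.linear scale (*) (\<lambda>x. c x b)" "\<And>x. x = (\<Sum>b\<in>B. scale (c x b) b)"
    using coordinates by metis
  have wf: "wf_trm lang arity n s" "wf_trm lang arity n t" using Eql by auto
  obtain f g where fg: "\<And>b. f b \<in> poly_maps scale n" "\<And>b. g b \<in> poly_maps scale n"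
    "\<And>b v. v \<in> tuples n \<Longrightarrow> c (eval_trm interp v s) b = f b ((!) v)"
    "\<And>b v. v \<in> tuples n \<Longrightarrow> c (eval_trm interp v t) b = g b ((!) v)"
    using functional_eval_trm[OF wf(1) B(2)] functional_eval_trm[OF wf(2) B(2)] by metis
  have "(\<Inter>b\<in>B. {v. f b v - g b v = 0}) \<in> constructible (poly_maps scale n)"
    by (intro pm.constructible_INT constructible.zero_set pm.diff fg B(1))
  \<comment> \<open>An equation in the algebra is a finite system of scalar equations.\<close>
  moreover have "x = y \<longleftrightarrow> (\<forall>b\<in>B. c x b = c y b)" for x y
    by (metis (no_types, lifting) B(3) sum.cong)
  then have "sat interp v (Eql s t) \<longleftrightarrow> (!) v \<in> (\<Inter>b\<in>B. {v. f b v - g b v = 0})" if "v \<in> tuples n" for v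
    using fg(3,4) that by simp
  ultimately show ?case by blast
next
  case (Neg \<phi>)
  then obtain C where "C \<in> constructible (poly_maps scale n)"
    "\<forall>v \<in> tuples n. sat interp v \<phi> \<longleftrightarrow> (!) v \<in> C" by auto
  then show ?case by (intro bexI[OF _ constructible.Compl[of C]]) auto
next
  case (Conj \<phi> \<psi>)
  then obtain C D where
    "C \<in> constructible (poly_maps scale n)" "\<forall>v \<in> tuples n. sat interp v \<phi> \<longleftrightarrow> (!) v \<in> C"
    "D \<in> constructible (poly_maps scale n)" "\<forall>v \<in> tuples n. sat interp v \<psi> \<longleftrightarrow> (!) v \<in> D"
    by (metis wf_fm.simps(3))
  then show ?case by (intro bexI[OF _ constructible.Int[of C _ D]]) auto
next
  case (Exi \<phi>)
  then obtain C where C: "C \<in> constructible (poly_maps scale (Suc n))"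
    "\<forall>v \<in> tuples (Suc n). sat interp v \<phi> \<longleftrightarrow> (!) v \<in> C" by auto
  have "sat interp (x # v) \<phi> \<longleftrightarrow> case_nat x ((!) v) \<in> C" if "v \<in> tuples n" for x v
  proof -
    \<comment> \<open>This also holds past the end of the list, because indexing into a cons always
      shifts.\<close>
    have "(!) (x # v) = case_nat x ((!) v)" by (auto simp: fun_eq_iff nth_Cons)
    then show ?thesis using C(2) that by (simp add: tuples_def)
  qed
  then show ?case by (intro bexI[OF _ constructible_ex[OF C(1)]]) simp
qed

end

section \<open>Invariant constructible sets and the main theorem\<close>

lemma poly_maps_constructible_cong:
  assumes "C \<in> constructible (poly_maps scale n)" "\<And>i. i < n \<Longrightarrow> v i = w i"
  shows "v \<in> C \<longleftrightarrow> w \<in> C"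
  using assms(1)
proof (induction rule: constructible.induct)
  case (zero_set f)
  then show ?case using poly_maps_cong[OF zero_set assms(2)] by simp
qed simp_all

lemma wf_trm_mono: "wf_trm L ar n t \<Longrightarrow> n \<le> n' \<Longrightarrow> wf_trm L ar n' t"
  by (induction t) auto

lemma eval_trm_append:
  "wf_trm L ar n t \<Longrightarrow> w \<in> tuples n \<Longrightarrow> eval_trm I (w @ c) t = eval_trm I w t"
proof (induction t)
  case (Fn f ts)
  then have "map (eval_trm I (w @ c)) ts = map (eval_trm I w) ts" by (intro map_cong refl) auto
  then show ?case by (simp del: map_eq_conv)
qed (simp add: tuples_def nth_append)

section \<open>Equivariance of terms and invariance of formulas\<close>

locale invariant_extension = fd_unital_algebra_acf scale mul u
  for scale :: "'k::{alg_closed_field, field_char_0} \<Rightarrow> 'a::ab_group_add \<Rightarrow> 'a"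
    and mul :: "'a \<Rightarrow> 'a \<Rightarrow> 'a" and u :: 'a +
  fixes G :: "('a \<Rightarrow> 'a) set" and S :: "nat \<Rightarrow> ('a list \<Rightarrow> 'k) set"
    and E :: "'e set" and ar :: "'e \<Rightarrow> nat" and IE :: "'e \<Rightarrow> 'a list \<Rightarrow> 'a"
  assumes G_subgroup: "subgroup G (ring_aut_group mul u)"
    and G_linear: "G \<subseteq> general_linear scale"
    and G_finite: "finite G"
    and S_generates: "subalgebra_gen (tuples m) (S m) = invariants scale G m"
    and E_interp: "e \<in> E \<Longrightarrow>
      \<exists>p \<in> invariants scale G (ar e). \<forall>a \<in> tuples (ar e). IE e a = scale (p a) u"
    and S_terms: "s \<in> S m \<Longrightarrow>
      \<exists>t. wf_trm (ring_ext_lang E) (ring_ext_arity ar) m t \<and>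
        (\<forall>a \<in> tuples m. eval_trm (ring_ext_interp mul u IE) a t = scale (s a) u)"
begin

sublocale poly_extension scale mul u E ar IE
proof
  show "\<exists>p \<in> poly_functions scale (ar e). \<forall>a \<in> tuples (ar e). IE e a = scale (p a) u" if "e \<in> E" for e
    using E_interp[OF that] unfolding invariants_def by blast
qed

lemma G_id: "id \<in> G"
  using subgroup.one_closed[OF G_subgroup] by (simp add: ring_aut_group_def)

lemma G_comp: "g \<in> G \<Longrightarrow> h \<in> G \<Longrightarrow> g \<circ> h \<in> G"
  using subgroup.m_closed[OF G_subgroup, of g h] by (simp add: ring_aut_group_def)

lemma G_aut:
  assumes "g \<in> G"
  shows G_bij: "bij g" and G_add: "g (x + y) = g x + g y" and G_diff: "g (x - y) = g x - g y"
    and G_mul: "g (mul x y) = mul (g x) (g y)" and G_0: "g 0 = 0" and G_unit: "g u = u"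
  using subgroup.subset[OF G_subgroup] assms by (auto simp: ring_aut_group_def)

lemma G_scale: "g \<in> G \<Longrightarrow> g (scale a x) = scale a (g x)"
  using G_linear by (auto simp: general_linear_def Vector_Spaces.linear_iff)

lemma invariants_map:
  assumes "p \<in> invariants scale G m" "g \<in> G" "a \<in> tuples m"
  shows "p (map g a) = p a"
proof -
  have "act m g p (map g a) = p (map (inv_into UNIV g) (map g a))"
    using assms(3) by (simp add: act_def tuples_def)
  also have "map (inv_into UNIV g) (map g a) = a"
    using G_bij[OF assms(2)] by (simp add: bij_is_inj)
  finally show ?thesis using assms by (simp add: invariants_def)
qed

text \<open>For a symbol of \<open>E\<close> the scalar coefficient is invariant and
  \<open>g\<close>, being linear and unital, fixes the multiples of \<open>u\<close>; the ring
  operations are preserved by automorphisms.\<close>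

lemma eval_trm_equivariant:
  assumes "wf_trm lang arity n t" "v \<in> tuples n" and g: "g \<in> G"
  shows "eval_trm interp (map g v) t = g (eval_trm interp v t)"
  using assms(1)
proof (induction t)
  case (Var i)
  then show ?case using assms(2) by (simp add: tuples_def)
next
  case (Fn f ts)
  let ?xs = "map (eval_trm interp v) ts"
  have eq: "map (eval_trm interp (map g v)) ts = map g ?xs" using Fn by auto
  have len: "length ts = arity f" "f \<in> lang" using Fn.prems by auto
  have "interp f (map g ?xs) = g (interp f ?xs)"
  proof (cases f)
    case (Ext e)
    then have "e \<in> E" using len by (auto simp: ring_ext_lang_def)
    then obtain p where p: "p \<in> invariants scale G (ar e)"
      "\<forall>a \<in> tuples (ar e). IE e a = scale (p a) u" using E_interp by blast
    have xs: "?xs \<in> tuples (ar e)" "map g ?xs \<in> tuples (ar e)"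
      using len Ext by (simp_all add: tuples_def)
    have "interp f (map g ?xs) = scale (p (map g ?xs)) u"
      using p(2) xs(2) Ext by simp
    also have "\<dots> = scale (p ?xs) u"
      by (simp only: invariants_map[OF p(1) g xs(1)])
    also have "\<dots> = g (interp f ?xs)"
      using p(2) xs(1) Ext g by (simp add: G_scale G_unit)
    finally show ?thesis .
  qed (use len g in \<open>simp_all add: G_add G_diff G_mul G_0 G_unit\<close>)
  then show ?case by (simp only: eval_trm.simps eq)
qed

text \<open>Injectivity of \<open>g\<close> reflects equations, and surjectivity provides witnesses
  for quantifiers.\<close>

lemma sat_invariant:
  assumes g: "g \<in> G"
  shows "wf_fm lang arity n \<phi> \<Longrightarrow> v \<in> tuples n \<Longrightarrow> sat interp (map g v) \<phi> \<longleftrightarrow> sat interp v \<phi>"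
proof (induction \<phi> arbitrary: n v)
  case (Eql s t)
  then show ?case
    using eval_trm_equivariant[of n s v g] eval_trm_equivariant[of n t v g] g
    by (simp add: inj_eq[OF bij_is_inj[OF G_bij[OF g]]])
next
  case (Exi \<phi>)
  have "sat interp (map g (x # v)) \<phi> \<longleftrightarrow> sat interp (x # v) \<phi>" for x
    using Exi.prems by (intro Exi.IH) (auto simp: tuples_def)
  then have "sat interp (g x # map g v) \<phi> \<longleftrightarrow> sat interp (x # v) \<phi>" for x by simp
  moreover have "\<exists>x. y = g x" for y using bij_is_surj[OF G_bij[OF g]] by (rule surjD)
  ultimately show ?case by (metis sat.simps(4))
qed auto

section \<open>Invariant polynomial maps and orbits\<close>

definition invariant_maps :: "nat \<Rightarrow> ((nat \<Rightarrow> 'a) \<Rightarrow> 'k) set" where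
  "invariant_maps n = {f \<in> poly_maps scale n. \<forall>g\<in>G. \<forall>v. f (\<lambda>i. g (v i)) = f v}"

sublocale invariant_maps: function_algebra "invariant_maps n" for n
  by unfold_locales (simp_all add: invariant_maps_def poly_maps.intros)

text \<open>Here maps are composed with \<open>g\<close>, whereas \<open>act\<close> uses the
  inverse; applying invariance at the preimage of \<open>w\<close> converts one convention into the
  other.\<close>

lemma invariant_maps_imp_invariants:
  assumes "f \<in> invariant_maps n"
  shows "(\<lambda>w\<in>tuples n. f ((!) w)) \<in> invariants scale G n"
proof -
  have f: "f \<in> poly_maps scale n" "\<And>g v. g \<in> G \<Longrightarrow> f (\<lambda>i. g (v i)) = f v"
    using assms by (auto simp: invariant_maps_def)
  have "f ((!) (map (inv_into UNIV g) w)) = f ((!) w)" if "g \<in> G" "w \<in> tuples n" for g w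
  proof -
    \<comment> \<open>The two sequences are compared at indices below \<open>n\<close> only, as
      \<open>map\<close> says nothing about indices past the end of \<open>w\<close>.\<close>
    have "f ((!) w) = f (\<lambda>i. g (map (inv_into UNIV g) w ! i))"
      using that bij_is_surj[OF G_bij[OF that(1)]]
      by (intro poly_maps_cong[OF f(1)]) (simp add: tuples_def surj_f_inv_f)
    also have "\<dots> = f ((!) (map (inv_into UNIV g) w))" by (rule f(2)[OF that(1)])
    finally show ?thesis by simp
  qed
  then have "act n g (\<lambda>w\<in>tuples n. f ((!) w)) = (\<lambda>w\<in>tuples n. f ((!) w))" if "g \<in> G" for g
    unfolding act_def using that by (intro restrict_ext) (simp add: tuples_def)
  then show ?thesis
    using poly_maps_imp_poly_functions[OF f(1)] by (simp add: invariants_def)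
qed

text \<open>For sufficiently many values of \<open>t\<close>, the simultaneous vanishing of these invariants says that
  \<open>fs\<close> vanishes identically at some point of the orbit of \<open>v\<close>.\<close>

definition orbit_norm :: "((nat \<Rightarrow> 'a) \<Rightarrow> 'k) list \<Rightarrow> 'k \<Rightarrow> (nat \<Rightarrow> 'a) \<Rightarrow> 'k" where
  "orbit_norm fs t v = (\<Prod>g\<in>G. poly (Poly (map (\<lambda>f. f (\<lambda>i. g (v i))) fs)) t)"

text \<open>Moving the point by \<open>h\<close> only permutes the factors, by right multiplication
  with \<open>h\<close> on the finite group \<open>G\<close>.\<close>

lemma orbit_norm_invariant:
  assumes "set fs \<subseteq> poly_maps scale n"
  shows "orbit_norm fs t \<in> invariant_maps n"
proof -
  have "(\<lambda>v. poly (Poly (map (\<lambda>f. f (\<lambda>i. g (v i))) fs)) t) \<in> poly_maps scale n" if g: "g \<in> G" for g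
    using assms
  proof (induction fs)
    case Nil
    then show ?case by (simp add: poly_maps.const)
  next
    case (Cons f fs)
    have "(\<lambda>v. f (\<lambda>i. g (v i))) \<in> poly_maps scale n"
    proof (rule poly_maps_subst)
      show "f \<in> poly_maps scale n" using Cons by simp
      fix i l assume "i < n" and l: "Vector_Spaces.linear scale (*) l"
      have "Vector_Spaces.linear scale (*) (\<lambda>x. l (g x))"
        using l g by (simp add: Vector_Spaces.linear_iff G_add G_scale)
      then show "(\<lambda>v. l (g (v i))) \<in> poly_maps scale n"
        using \<open>i < n\<close> by (rule poly_maps.coord[rotated])
    qed
    then show ?case using Cons by (simp add: poly_maps.intros)
  qed
  then have "orbit_norm fs t \<in> poly_maps scale n"
    unfolding orbit_norm_def[abs_def] by (intro pm.prod G_finite)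
  moreover have "orbit_norm fs t (\<lambda>i. h (v i)) = orbit_norm fs t v" if h: "h \<in> G" for h v
  proof -
    have inj: "inj_on (\<lambda>g. g \<circ> h) G"
      using bij_is_surj[OF G_bij[OF h]] by (auto simp: inj_on_def fun_eq_iff) (metis surjD)
    have "(\<lambda>g. g \<circ> h) ` G = G"
      using G_comp h by (intro endo_inj_surj G_finite inj) auto
    then have "orbit_norm fs t v =
        (\<Prod>g \<in> (\<lambda>g. g \<circ> h) ` G. poly (Poly (map (\<lambda>f. f (\<lambda>i. g (v i))) fs)) t)"
      by (simp add: orbit_norm_def)
    also have "\<dots> = orbit_norm fs t (\<lambda>i. h (v i))"
      by (subst prod.reindex[OF inj]) (simp add: orbit_norm_def)
    finally show ?thesis by simp
  qed
  ultimately show ?thesis by (simp add: invariant_maps_def)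
qed

text \<open>As a polynomial in \<open>t\<close> the norm has degree at most
  \<open>card G * length fs\<close>, so vanishing on \<open>T\<close> makes it zero. Then one factor
  is the zero polynomial, and its coefficients are the values of \<open>fs\<close> at a point of the
  orbit.\<close>

lemma orbit_norm_vanishes_iff:
  assumes T: "finite T" "card G * length fs < card T"
  shows "(\<forall>t\<in>T. orbit_norm fs t v = 0) \<longleftrightarrow> (\<exists>g\<in>G. \<forall>f\<in>set fs. f (\<lambda>i. g (v i)) = 0)"
proof -
  let ?p = "\<lambda>g. Poly (map (\<lambda>f. f (\<lambda>i. g (v i))) fs)"
  have zero: "?p g = 0 \<longleftrightarrow> (\<forall>f\<in>set fs. f (\<lambda>i. g (v i)) = 0)" for g
    by (induction fs) auto
  have norm: "orbit_norm fs t v = poly (\<Prod>g\<in>G. ?p g) t" for t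
    by (simp add: orbit_norm_def poly_prod)
  have "(\<forall>t\<in>T. poly (\<Prod>g\<in>G. ?p g) t = 0) \<longleftrightarrow> (\<Prod>g\<in>G. ?p g) = 0"
  proof
    assume root: "\<forall>t\<in>T. poly (\<Prod>g\<in>G. ?p g) t = 0"
    show "(\<Prod>g\<in>G. ?p g) = 0"
    proof (rule ccontr)
      assume nz: "(\<Prod>g\<in>G. ?p g) \<noteq> 0"
      have "card T \<le> card {t. poly (\<Prod>g\<in>G. ?p g) t = 0}"
        using root by (intro card_mono poly_roots_finite nz) auto
      also have "\<dots> \<le> degree (\<Prod>g\<in>G. ?p g)" by (rule card_poly_roots_bound[OF nz])
      also have "\<dots> \<le> (\<Sum>g\<in>G. degree (?p g))"
        using degree_prod_sum_le[OF G_finite, of ?p] by (simp add: comp_def)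
      also have "\<dots> \<le> (\<Sum>g\<in>G. length fs)"
        by (intro sum_mono order.trans[OF degree_Poly]) simp
      finally show False using T(2) by simp
    qed
  qed simp
  then show ?thesis by (simp add: norm zero prod_zero_iff[OF G_finite])
qed

text \<open>The norms tell which subsets of \<open>F\<close> vanish together somewhere on an orbit.
  This determines the maximal patterns on the orbit, and a single common pattern suffices because
  \<open>D\<close> is a union of orbits.\<close>

lemma invariant_constructible:
  assumes D: "D \<in> constructible (poly_maps scale n)"
    and inv: "\<And>g v. g \<in> G \<Longrightarrow> (\<lambda>i. g (v i)) \<in> D \<longleftrightarrow> v \<in> D"
  shows "D \<in> constructible (invariant_maps n)"
proof -
  obtain F where F: "finite F" "F \<subseteq> poly_maps scale n"
    "\<forall>x y. (\<forall>f\<in>F. f x = 0 \<longleftrightarrow> f y = 0) \<longrightarrow> (x \<in> D \<longleftrightarrow> y \<in> D)"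
    by (rule constructible_depends_finite[OF D]) (rule that)
  obtain fl where fl: "set fl = F" using finite_list[OF F(1)] ..
  \<comment> \<open>Large enough for every sublist of \<open>fl\<close> at once.\<close>
  obtain T :: "'k set" where T: "finite T" "card T = Suc (card G * length fl)"
    using infinite_arbitrarily_large[OF infinite_UNIV_char_0, of "Suc (card G * length fl)"] by blast
  define sub where "sub P = filter (\<lambda>f. f \<in> P) fl" for P
  have set_sub: "set (sub P) = P" if "P \<subseteq> F" for P using that fl by (auto simp: sub_def)
  have card_sub: "card G * length (sub P) < card T" for P
    using T(2) by (simp add: sub_def less_Suc_eq_le)
  let ?N = "(\<lambda>(P, t). orbit_norm (sub P) t) ` (Pow F \<times> T)"
  let ?pat = "\<lambda>v. {f \<in> F. f v = 0}" and ?act = "\<lambda>g v i. g (v i)"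
  show ?thesis
  proof (rule invariant_maps.constructible_if_depends_finite)
    show "finite ?N" using F(1) T(1) by simp
    show "?N \<subseteq> invariant_maps n"
      using set_sub F(2) by (auto intro!: orbit_norm_invariant)
  next
    fix x y assume same: "{f \<in> ?N. f x = 0} = {f \<in> ?N. f y = 0}" and "x \<in> D"
    have transfer: "(\<exists>g\<in>G. P \<subseteq> ?pat (?act g x)) \<longleftrightarrow> (\<exists>g\<in>G. P \<subseteq> ?pat (?act g y))"
      if P: "P \<subseteq> F" for P
    proof -
      have orbit: "(\<forall>t\<in>T. orbit_norm (sub P) t v = 0) \<longleftrightarrow> (\<exists>g\<in>G. P \<subseteq> ?pat (?act g v))" for v
        unfolding orbit_norm_vanishes_iff[OF T(1) card_sub] set_sub[OF P] using P by blast
      have "orbit_norm (sub P) t x = 0 \<longleftrightarrow> orbit_norm (sub P) t y = 0" if "t \<in> T" for t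
      proof -
        have "orbit_norm (sub P) t \<in> ?N" using P that by force
        then show ?thesis using same by blast
      qed
      then show ?thesis unfolding orbit[symmetric] by simp
    qed
    \<comment> \<open>Choose a point in the orbit of \<open>x\<close> where the most functions
      vanish. Its pattern lies in a pattern on the orbit of \<open>y\<close>, which in turn lies in
      one on the orbit of \<open>x\<close>; maximality forces the first two to coincide.\<close>
    have "Max ((\<lambda>g. card (?pat (?act g x))) ` G) \<in> (\<lambda>g. card (?pat (?act g x))) ` G"
      using G_finite G_id by (intro Max_in) auto
    then obtain g0 where g0: "g0 \<in> G"
      "Max ((\<lambda>g. card (?pat (?act g x))) ` G) = card (?pat (?act g0 x))" by (rule imageE)
    have max: "card (?pat (?act g x)) \<le> card (?pat (?act g0 x))" if "g \<in> G" for g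
      unfolding g0(2)[symmetric] using G_finite that by (intro Max_ge) auto
    obtain h where h: "h \<in> G" "?pat (?act g0 x) \<subseteq> ?pat (?act h y)"
      using transfer[of "?pat (?act g0 x)"] g0(1) by blast
    obtain g1 where g1: "g1 \<in> G" "?pat (?act h y) \<subseteq> ?pat (?act g1 x)"
      using transfer[of "?pat (?act h y)"] h(1) by blast
    have "card (?pat (?act h y)) \<le> card (?pat (?act g1 x))"
      using g1(2) F(1) by (intro card_mono) auto
    then have "?pat (?act g0 x) = ?pat (?act h y)"
      using max[OF g1(1)] h(2) F(1) by (intro card_seteq) auto
    then have "?act g0 x \<in> D \<longleftrightarrow> ?act h y \<in> D"
      using F(3)[rule_format, of "?act g0 x" "?act h y"] by blast
    then show "y \<in> D" using inv g0(1) h(1) \<open>x \<in> D\<close> by simp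
  qed
qed

text \<open>The constants used by a term are supplied as parameters. Asking only that the list \<open>c\<close> contains
  a given finite set lets two terms share their parameters without renaming variables.\<close>

lemma invariant_term:
  assumes "f \<in> invariants scale G n"
  shows "\<exists>K. finite K \<and> (\<forall>c. K \<subseteq> set c \<longrightarrow> (\<exists>t. wf_trm lang arity (n + length c) t \<and>
    (\<forall>w\<in>tuples n. eval_trm interp (w @ c) t = scale (f w) u)))"
  using assms unfolding S_generates[symmetric]
proof (induction rule: subalgebra_gen.induct)
  case (const a)
  show ?case
  proof (intro exI[of _ "{scale a u}"] conjI allI impI)
    fix c assume "{scale a u} \<subseteq> set c"
    then obtain j where j: "j < length c" "c ! j = scale a u" by (auto simp: in_set_conv_nth)
    then show "\<exists>t. wf_trm lang arity (n + length c) t \<and>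
        (\<forall>w\<in>tuples n. eval_trm interp (w @ c) t = scale ((\<lambda>x\<in>tuples n. a) w) u)"
      \<comment> \<open>The parameters follow the \<open>n\<close> variables, hence the shift of the
        index.\<close>
      by (intro exI[of _ "Var (n + j)"]) (auto simp: tuples_def nth_append)
  qed simp
next
  case (gen s)
  then obtain t where t: "wf_trm lang arity n t"
    "\<forall>a \<in> tuples n. eval_trm interp a t = scale (s a) u" using S_terms by blast
  show ?case
    by (intro exI[of _ "{}"] conjI allI impI exI[of _ t])
      (use t in \<open>auto simp: eval_trm_append intro: wf_trm_mono\<close>)
next
  case (add f g)
  then obtain K K' where K: "finite K" "finite K'"
    "\<And>c. K \<subseteq> set c \<Longrightarrow> \<exists>t. wf_trm lang arity (n + length c) t \<and>
      (\<forall>w\<in>tuples n. eval_trm interp (w @ c) t = scale (f w) u)"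
    "\<And>c. K' \<subseteq> set c \<Longrightarrow> \<exists>t. wf_trm lang arity (n + length c) t \<and>
      (\<forall>w\<in>tuples n. eval_trm interp (w @ c) t = scale (g w) u)" by metis
  show ?case
  proof (intro exI[of _ "K \<union> K'"] conjI allI impI)
    fix c assume "K \<union> K' \<subseteq> set c"
    then obtain s t where "wf_trm lang arity (n + length c) s" "wf_trm lang arity (n + length c) t"
      "\<forall>w\<in>tuples n. eval_trm interp (w @ c) s = scale (f w) u"
      "\<forall>w\<in>tuples n. eval_trm interp (w @ c) t = scale (g w) u" using K(3,4)[of c] by auto
    then show "\<exists>t. wf_trm lang arity (n + length c) t \<and>
        (\<forall>w\<in>tuples n. eval_trm interp (w @ c) t = scale ((\<lambda>x\<in>tuples n. f x + g x) w) u)"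
      by (intro exI[of _ "Fn RPlus [s, t]"])
        (auto simp: ring_ext_lang_def scale_left_distrib)
  qed (use K in simp)
next
  case (mul f g)
  then obtain K K' where K: "finite K" "finite K'"
    "\<And>c. K \<subseteq> set c \<Longrightarrow> \<exists>t. wf_trm lang arity (n + length c) t \<and>
      (\<forall>w\<in>tuples n. eval_trm interp (w @ c) t = scale (f w) u)"
    "\<And>c. K' \<subseteq> set c \<Longrightarrow> \<exists>t. wf_trm lang arity (n + length c) t \<and>
      (\<forall>w\<in>tuples n. eval_trm interp (w @ c) t = scale (g w) u)" by metis
  \<comment> \<open>Multiples of the unit multiply like scalars, so the product in the algebra
    computes products of invariants.\<close>
  have unit: "mul (scale a u) (scale b u) = scale (a * b) u" for a b
    using linear_mul_left[of "scale b u"] by (simp add: Vector_Spaces.linear_iff left_unit)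
  show ?case
  proof (intro exI[of _ "K \<union> K'"] conjI allI impI)
    fix c assume "K \<union> K' \<subseteq> set c"
    then obtain s t where "wf_trm lang arity (n + length c) s" "wf_trm lang arity (n + length c) t"
      "\<forall>w\<in>tuples n. eval_trm interp (w @ c) s = scale (f w) u"
      "\<forall>w\<in>tuples n. eval_trm interp (w @ c) t = scale (g w) u" using K(3,4)[of c] by auto
    then show "\<exists>t. wf_trm lang arity (n + length c) t \<and>
        (\<forall>w\<in>tuples n. eval_trm interp (w @ c) t = scale ((\<lambda>x\<in>tuples n. f x * g x) w) u)"
      by (intro exI[of _ "Fn RTimes [s, t]"]) (auto simp: ring_ext_lang_def unit)
  qed (use K in simp)
qed

section \<open>Quantifier-free formulas for invariant constructible sets\<close>

lemma trivial_algebra: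
  fixes x :: 'a
  assumes "u = 0"
  shows "x = 0"
  using linear_mul_left[of x] left_unit[of x] assms
  by (metis Vector_Spaces.linear_iff scale_zero_left)

text \<open>If \<open>u\<close> is nonzero, a multiple of \<open>u\<close> vanishes iff its
  coefficient does, so an equation between terms expresses the zero set. In the zero algebra this
  test loses all information, but there is only one point, so \<open>f\<close> is constant.\<close>

lemma qf_formula_zero_set:
  assumes f: "f \<in> invariant_maps n"
  shows "\<exists>K. finite K \<and> (\<forall>c. K \<subseteq> set c \<longrightarrow> (\<exists>\<psi>. qfree \<psi> \<and> wf_fm lang arity (n + length c) \<psi> \<and>
    (\<forall>w\<in>tuples n. sat interp (w @ c) \<psi> \<longleftrightarrow> f ((!) w) = 0)))"
proof (cases "u = 0")
  case False
  obtain K where K: "finite K" "\<And>c. K \<subseteq> set c \<Longrightarrow> \<exists>t. wf_trm lang arity (n + length c) t \<and>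
      (\<forall>w\<in>tuples n. eval_trm interp (w @ c) t = scale ((\<lambda>w\<in>tuples n. f ((!) w)) w) u)"
    using invariant_term[OF invariant_maps_imp_invariants[OF f]] by metis
  show ?thesis
  proof (intro exI[of _ K] conjI allI impI K(1))
    fix c assume "K \<subseteq> set c"
    then obtain t where "wf_trm lang arity (n + length c) t"
      "\<forall>w\<in>tuples n. eval_trm interp (w @ c) t = scale (f ((!) w)) u" using K(2)[of c] by auto
    then show "\<exists>\<psi>. qfree \<psi> \<and> wf_fm lang arity (n + length c) \<psi> \<and>
        (\<forall>w\<in>tuples n. sat interp (w @ c) \<psi> \<longleftrightarrow> f ((!) w) = 0)"
      using False by (intro exI[of _ "Eql t (Fn RZero [])"]) (auto simp: ring_ext_lang_def)
  qed
next
  case True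
  have "f \<in> poly_maps scale n" using f by (simp add: invariant_maps_def)
  then have "f v = f (\<lambda>i. 0)" for v
    by (rule poly_maps_cong) (rule trivial_algebra[OF True])
  then obtain a where eq: "\<And>v. f v = a" by blast
  let ?true = "Eql (Fn RZero []) (Fn RZero [])"
  let ?\<psi> = "if a = 0 then ?true else Neg ?true"
  show ?thesis
    by (intro exI[of _ "{}"] conjI allI impI exI[of _ ?\<psi>])
      (use eq in \<open>auto simp: ring_ext_lang_def\<close>)
qed

lemma qf_formula:
  assumes "C \<in> constructible (invariant_maps n)"
  shows "\<exists>K. finite K \<and> (\<forall>c. K \<subseteq> set c \<longrightarrow> (\<exists>\<psi>. qfree \<psi> \<and> wf_fm lang arity (n + length c) \<psi> \<and>
    (\<forall>w\<in>tuples n. sat interp (w @ c) \<psi> \<longleftrightarrow> (!) w \<in> C)))"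
  using assms
proof (induction rule: constructible.induct)
  case (zero_set f)
  then show ?case using qf_formula_zero_set by simp
next
  case (Compl A)
  then obtain K where K: "finite K" "\<And>c. K \<subseteq> set c \<Longrightarrow> \<exists>\<psi>. qfree \<psi> \<and>
    wf_fm lang arity (n + length c) \<psi> \<and> (\<forall>w\<in>tuples n. sat interp (w @ c) \<psi> \<longleftrightarrow> (!) w \<in> A)"
    by metis
  show ?case
  proof (intro exI[of _ K] conjI allI impI K(1))
    fix c assume "K \<subseteq> set c"
    then obtain \<psi> where "qfree \<psi>" "wf_fm lang arity (n + length c) \<psi>"
      "\<forall>w\<in>tuples n. sat interp (w @ c) \<psi> \<longleftrightarrow> (!) w \<in> A" using K(2) by blast
    then show "\<exists>\<psi>. qfree \<psi> \<and> wf_fm lang arity (n + length c) \<psi> \<and>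
        (\<forall>w\<in>tuples n. sat interp (w @ c) \<psi> \<longleftrightarrow> (!) w \<in> - A)"
      by (intro exI[of _ "Neg \<psi>"]) simp
  qed
next
  case (Int A B)
  then obtain K K' where K: "finite K" "finite K'"
    "\<And>c. K \<subseteq> set c \<Longrightarrow> \<exists>\<psi>. qfree \<psi> \<and> wf_fm lang arity (n + length c) \<psi> \<and>
      (\<forall>w\<in>tuples n. sat interp (w @ c) \<psi> \<longleftrightarrow> (!) w \<in> A)"
    "\<And>c. K' \<subseteq> set c \<Longrightarrow> \<exists>\<psi>. qfree \<psi> \<and> wf_fm lang arity (n + length c) \<psi> \<and>
      (\<forall>w\<in>tuples n. sat interp (w @ c) \<psi> \<longleftrightarrow> (!) w \<in> B)"
    by metis
  show ?case
  proof (intro exI[of _ "K \<union> K'"] conjI allI impI)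
    fix c assume c: "K \<union> K' \<subseteq> set c"
    obtain \<psi> where "qfree \<psi>" "wf_fm lang arity (n + length c) \<psi>"
      "\<forall>w\<in>tuples n. sat interp (w @ c) \<psi> \<longleftrightarrow> (!) w \<in> A" using K(3)[of c] c by blast
    moreover obtain \<chi> where "qfree \<chi>" "wf_fm lang arity (n + length c) \<chi>"
      "\<forall>w\<in>tuples n. sat interp (w @ c) \<chi> \<longleftrightarrow> (!) w \<in> B" using K(4)[of c] c by blast
    ultimately show "\<exists>\<psi>. qfree \<psi> \<and> wf_fm lang arity (n + length c) \<psi> \<and>
        (\<forall>w\<in>tuples n. sat interp (w @ c) \<psi> \<longleftrightarrow> (!) w \<in> A \<inter> B)"
      by (intro exI[of _ "Conj \<psi> \<chi>"]) simp
  qed (use K in simp)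
qed

text \<open>With its parameters fixed, a definable set may fail to be \<open>G\<close>-stable. The
  parameters \<open>b\<close> are therefore treated as further variables, which gives a
  \<open>G\<close>-stable set of \<open>n\<close>-tuples, and are put back after the
  elimination.\<close>

theorem quantifier_elimination: "admits_QE lang arity interp"
  unfolding admits_QE_def
proof (intro allI impI)
  fix m X assume "definable lang arity interp m X"
  then obtain \<phi> b where \<phi>: "wf_fm lang arity (m + length b) \<phi>"
    and X: "X = {v \<in> tuples m. sat interp (v @ b) \<phi>}"
    by (auto simp: definable_def)
  define n where "n = m + length b"
  have wf: "wf_fm lang arity n \<phi>" using \<phi> by (simp add: n_def)
  obtain C where C: "C \<in> constructible (poly_maps scale n)"
    "\<And>w. w \<in> tuples n \<Longrightarrow> sat interp w \<phi> \<longleftrightarrow> (!) w \<in> C"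
    using definable_constructible[OF wf] by blast
  have "(\<lambda>i. g (v i)) \<in> C \<longleftrightarrow> v \<in> C" if g: "g \<in> G" for g v
  proof -
    \<comment> \<open>Invariance is known for lists; membership in \<open>C\<close> depends only on
      the first \<open>n\<close> entries, so \<open>v\<close> may be truncated.\<close>
    let ?w = "map v [0..<n]"
    have w: "?w \<in> tuples n" "map g ?w \<in> tuples n" by (simp_all add: tuples_def)
    have "(\<lambda>i. g (v i)) \<in> C \<longleftrightarrow> (!) (map g ?w) \<in> C"
      by (rule poly_maps_constructible_cong[OF C(1)]) simp
    also have "\<dots> \<longleftrightarrow> (!) ?w \<in> C"
      using sat_invariant[OF g wf w(1)] C(2)[OF w(1)] C(2)[OF w(2)] by simp
    also have "\<dots> \<longleftrightarrow> v \<in> C"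
      by (rule poly_maps_constructible_cong[OF C(1)]) simp
    finally show ?thesis .
  qed
  then have "C \<in> constructible (invariant_maps n)"
    by (rule invariant_constructible[OF C(1)])
  then obtain K where K: "finite K" "\<And>c. K \<subseteq> set c \<Longrightarrow> \<exists>\<psi>. qfree \<psi> \<and>
    wf_fm lang arity (n + length c) \<psi> \<and> (\<forall>w\<in>tuples n. sat interp (w @ c) \<psi> \<longleftrightarrow> (!) w \<in> C)"
    using qf_formula by metis
  obtain c where "set c = K" using finite_list[OF K(1)] ..
  then obtain \<psi> where \<psi>: "qfree \<psi>" "wf_fm lang arity (n + length c) \<psi>"
    "\<And>w. w \<in> tuples n \<Longrightarrow> sat interp (w @ c) \<psi> \<longleftrightarrow> (!) w \<in> C"
    using K(2)[of c] by blast
  have "sat interp (v @ b) \<phi> \<longleftrightarrow> sat interp (v @ b @ c) \<psi>" if "v \<in> tuples m" for v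
  proof -
    have "v @ b \<in> tuples n" using that by (simp add: tuples_def n_def)
    then show ?thesis using C(2) \<psi>(3)[of "v @ b"] by simp
  qed
  \<comment> \<open>The new parameters are the old ones followed by the constants needed to write
    the invariants as terms.\<close>
  then have "X = {v \<in> tuples m. sat interp (v @ (b @ c)) \<psi>}" unfolding X by auto
  then show "qf_definable lang arity interp m X"
    unfolding qf_definable_def using \<psi>(1,2)
    by (intro exI[of _ \<psi>] exI[of _ "b @ c"] conjI) (simp_all only: n_def length_append add.assoc)
qed

end

theorem theorem2p9:
  fixes scale :: "'k::{alg_closed_field, field_char_0} \<Rightarrow> 'a::ab_group_add \<Rightarrow> 'a"
    and mul :: "'a \<Rightarrow> 'a \<Rightarrow> 'a" and u :: 'a
    and G :: "('a \<Rightarrow> 'a) set"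
    and S :: "nat \<Rightarrow> ('a list \<Rightarrow> 'k) set"
    and E :: "'e set" and ar :: "'e \<Rightarrow> nat" and IE :: "'e \<Rightarrow> 'a list \<Rightarrow> 'a"
  assumes algebra: "fd_unital_algebra scale mul u"
    and G_subgroup: "subgroup G (ring_aut_group mul u)"
    and G_linear: "G \<subseteq> general_linear scale"
    and G_finite: "finite G"
    and S_min: "\<And>m. minimal_generating_set (tuples m) (invariants scale G m) (S m)"
    and E_interp: "\<And>e. e \<in> E \<Longrightarrow>
      \<exists>p \<in> invariants scale G (ar e). \<forall>a \<in> tuples (ar e). IE e a = scale (p a) u"
    and S_terms: "\<And>m s. s \<in> S m \<Longrightarrow>
      \<exists>t. wf_trm (ring_ext_lang E) (ring_ext_arity ar) m t \<and>
        (\<forall>a \<in> tuples m. eval_trm (ring_ext_interp mul u IE) a t = scale (s a) u)"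
  shows "admits_QE (ring_ext_lang E) (ring_ext_arity ar) (ring_ext_interp mul u IE)"
proof -
  interpret invariant_extension scale mul u G S E ar IE
  proof (intro invariant_extension.intro fd_unital_algebra_acf.intro invariant_extension_axioms.intro)
    show "subalgebra_gen (tuples m) (S m) = invariants scale G m" for m
      using S_min by (simp add: minimal_generating_set_def)
  qed (fact algebra G_subgroup G_linear G_finite E_interp S_terms)+
  show ?thesis by (fact quantifier_elimination)
qed

end
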